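(* Let $X=(X_t)_{t\ge 0}$ be a time-homogeneous continuous-time Markov process on a countable set $S$, started in a fixed state $i\in S$, with transition probabilities $p_t(i,j)$. Let $L^i_t=\int_0^t\delta_i(X_s)\,ds$, let $G_\infty(i,i)=\int_0^\infty p_s(i,i)\,ds\in(0,\infty]$, and for $\gamma\ge 0$ let $$r(\gamma)=\lim_{t\to\infty}\frac1t\log\mathbb{E}^i\big[e^{\gamma L^i_t}\big].$$ Then the following hold for $\gamma\ge 0$: (1) $r(\gamma)\ge 0$, and $r(\gamma)>0$ if and only if $\gamma>1/G_\infty(i,i)$; (2) the function $\gamma\mapsto r(\gamma)$ is strictly convex for $\gamma>1/G_\infty(i,i)$; (3) $r(\gamma)\le\gamma$ for all $\gamma$, and $r(\gamma)/\gamma\to 1$ as $\gamma\to\infty$.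
   Context: Here $p_t(i,j)=\mathbb{P}[X_t=j\mid X_0=i]$ for $i,j\in S$, and $\mathbb{E}^i$ denotes expectation for the process with $X_0=i$. The function $t\mapsto p_t(i,i)$ is continuous on $[0,\infty)$ with $p_0(i,i)=1$. The function $\delta_i$ is the indicator of the state $i$ ($\delta_i(x)=1$ if $x=i$ and $0$ otherwise), so $L^i_t$ is the time $X$ spends at $i$ up to time $t$. The convention $1/\infty=0$ is used for $1/G_\infty(i,i)$. The quantity $r(\gamma)$ is called the exponential growth rate; the limit defining it exists for every $\gamma\ge0$.
   Formalization: Part (2) is proved only if some state j≠i has p_s(i,j)>0 and p_t(j,i)>0 for some s,t; otherwise (e.g. i absorbing) p_t(i,i)=e^{-ct} and r(γ)=max(0,γ-c) is affine above 1/G_∞(i,i), so (2) as stated is false there. *)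

theory Defs
  imports "HOL-Probability.Probability"
begin

definition transition_function :: "'s set \<Rightarrow> (real \<Rightarrow> 's \<Rightarrow> 's \<Rightarrow> real) \<Rightarrow> bool" where
  "transition_function S p \<longleftrightarrow>
     (\<forall>t\<ge>0. \<forall>x\<in>S. (\<forall>y\<in>S. 0 \<le> p t x y) \<and> (p t x has_sum 1) S) \<and>
     (\<forall>x\<in>S. \<forall>y\<in>S. p 0 x y = indicator {x} y) \<and>
     (\<forall>s\<ge>0. \<forall>t\<ge>0. \<forall>x\<in>S. \<forall>z\<in>S. ((\<lambda>y. p s x y * p t y z) has_sum p (s + t) x z) S)"

(* Joint measurability in (t, omega) is what makes the occupation time below a random variable;
   no path regularity is assumed. The values X t for t < 0 are irrelevant. *)
locale homogeneous_markov_process = prob_space M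
  for M :: "'w measure"
    and S :: "'s set"
    and X :: "real \<Rightarrow> 'w \<Rightarrow> 's"
    and p :: "real \<Rightarrow> 's \<Rightarrow> 's \<Rightarrow> real" +
  assumes countable_states: "countable S"
    and transition: "transition_function S p"
    and measurable_process:
      "(\<lambda>(t, \<omega>). X t \<omega>) \<in> restrict_space borel {0..} \<Otimes>\<^sub>M M \<rightarrow>\<^sub>M count_space S"
    and markov_property:
      "\<And>n (t :: nat \<Rightarrow> real) y s z.
         0 \<le> t 0 \<Longrightarrow> strict_mono_on {..n} t \<Longrightarrow> (\<And>k. k \<le> n \<Longrightarrow> y k \<in> S) \<Longrightarrow> 0 \<le> s \<Longrightarrow> z \<in> S \<Longrightarrow>
         0 < \<P>(\<omega> in M. \<forall>k\<le>n. X (t k) \<omega> = y k) \<Longrightarrow>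
         \<P>(\<omega> in M. X (t n + s) \<omega> = z \<bar> \<forall>k\<le>n. X (t k) \<omega> = y k) = p s (y n) z"

definition occupation_time :: "(real \<Rightarrow> 'w \<Rightarrow> 's) \<Rightarrow> 's \<Rightarrow> real \<Rightarrow> 'w \<Rightarrow> real" where
  "occupation_time X i t \<omega> = (LBINT s:{0..t}. indicator {i} (X s \<omega>))"

definition green :: "(real \<Rightarrow> 's \<Rightarrow> 's \<Rightarrow> real) \<Rightarrow> 's \<Rightarrow> 's \<Rightarrow> ennreal" where
  "green p i j = (\<integral>\<^sup>+ s\<in>{0..}. ennreal (p s i j) \<partial>lborel)"

definition log_moment_rate ::
    "'w measure \<Rightarrow> (real \<Rightarrow> 'w \<Rightarrow> 's) \<Rightarrow> 's \<Rightarrow> real \<Rightarrow> real \<Rightarrow> real" where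
  "log_moment_rate M X i \<gamma> t = 1 / t * ln (\<integral>\<omega>. exp (\<gamma> * occupation_time X i t \<omega>) \<partial>M)"

definition growth_rate :: "'w measure \<Rightarrow> (real \<Rightarrow> 'w \<Rightarrow> 's) \<Rightarrow> 's \<Rightarrow> real \<Rightarrow> real" where
  "growth_rate M X i \<gamma> = Lim at_top (log_moment_rate M X i \<gamma>)"

definition strictly_convex_on :: "real set \<Rightarrow> (real \<Rightarrow> real) \<Rightarrow> bool" where
  "strictly_convex_on A f \<longleftrightarrow> convex A \<and>
     (\<forall>x\<in>A. \<forall>y\<in>A. \<forall>u. x \<noteq> y \<longrightarrow> 0 < u \<longrightarrow> u < 1 \<longrightarrow>
        f ((1 - u) * x + u * y) < (1 - u) * f x + u * f y)"

(* If this fails, then p t i i = exp (- c * t) for some c \<ge> 0 and the growth rate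
   is max 0 (\<gamma> - c), which is not strictly convex above the threshold c. *)
definition can_leave_and_return ::
    "'s set \<Rightarrow> (real \<Rightarrow> 's \<Rightarrow> 's \<Rightarrow> real) \<Rightarrow> 's \<Rightarrow> bool" where
  "can_leave_and_return S p i \<longleftrightarrow>
     (\<exists>j\<in>S - {i}. \<exists>s\<ge>0. \<exists>t\<ge>0. 0 < p s i j \<and> 0 < p t j i)"

end

theory Submission
  imports Defs "HOL-Complex_Analysis.Conformal_Mappings" "HOL-Real_Asymp.Real_Asymp"
begin

text \<open>
  Write \<open>f t = p t i i\<close> for the return function and \<open>m t\<close> for the exponential moment
  \<open>E (exp (\<gamma> * L t))\<close> of the occupation time. Decomposing according to the time \<open>s\<close> of a visit to
  \<open>i\<close>, after which the process starts afresh, gives the renewal equation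
  \<open>m t = 1 + \<gamma> * (integral of f s * m (t - s) over 0 \<le> s \<le> t)\<close> (\<open>mgf_renewal\<close>). Comparing its solution with
  the exponentials \<open>exp (l * t)\<close> shows that \<open>m\<close> grows at the rate \<open>r\<close> at which
  \<open>\<gamma> * laplace f r\<close> crosses the value \<open>1\<close>, or at rate \<open>0\<close> if that product stays below \<open>1\<close>
  (\<open>rate_tendsto\<close>, \<open>critical_exponent\<close>). The Laplace transform \<open>laplace f\<close> decreases strictly and its
  supremum is the Green function, so the threshold is the reciprocal of the Green function; and
  \<open>l * laplace f l\<close> is at most \<open>1\<close> and tends to \<open>1\<close>, which gives \<open>r \<le> \<gamma>\<close> and \<open>r / \<gamma> \<longlonglongrightarrow> 1\<close>.

  Convexity of the growth rate is inherited from the convexity of \<open>\<gamma> \<mapsto> ln (m t)\<close>. If it were not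
  strict above the threshold, the growth rate would be affine on some interval there. Being inverse to
  \<open>l \<mapsto> 1 / laplace f l\<close>, it would force \<open>1 / laplace f\<close> to be affine on an interval, and then by analytic
  continuation everywhere: \<open>laplace f l = 1 / (l + c)\<close>. Since \<open>f\<close> is supermultiplicative, this
  identity already implies \<open>f t = exp (- c * t)\<close> (\<open>exponential_of_laplace\<close>), so \<open>f\<close> is
  multiplicative. But if \<open>i\<close> can be left and reached again, then an excursion through another state
  contributes to \<open>f (s + t)\<close> on top of \<open>f s * f t\<close> for some \<open>s\<close> and \<open>t\<close>.
\<close>

section \<open>The Laplace transform of a return function\<close>

lemma exp_decay_set_integral:
  fixes l T :: real
  assumes "0 < l"
  shows "set_integrable lborel {T..} (\<lambda>s. exp (- (l * s)))"
    and "(LBINT s:{T..}. exp (- (l * s))) = exp (- (l * T)) / l"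
proof -
  have "((\<lambda>s. - (exp (- (l * s)) / l)) \<longlongrightarrow> 0) at_top"
    using assms by real_asymp
  then have "(\<integral>\<^sup>+s. ennreal (exp (- (l * s))) * indicator {T..} s \<partial>lborel)
      = 0 - (- (exp (- (l * T)) / l))"
    using assms
    by (intro nn_integral_FTC_atLeast) (auto intro!: derivative_eq_intros simp: field_simps)
  then have nn: "(\<integral>\<^sup>+s. ennreal (indicator {T..} s *\<^sub>R exp (- (l * s))) \<partial>lborel)
      = ennreal (exp (- (l * T)) / l)"
    by (auto simp: indicator_def mult.commute intro!: nn_integral_cong cong: if_cong
        elim!: trans[rotated])
  then have "has_bochner_integral lborel (\<lambda>s. indicator {T..} s *\<^sub>R exp (- (l * s))) (exp (- (l * T)) / l)"
    using assms by (intro has_bochner_integral_nn_integral) auto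
  then show "set_integrable lborel {T..} (\<lambda>s. exp (- (l * s)))"
    "(LBINT s:{T..}. exp (- (l * s))) = exp (- (l * T)) / l"
    unfolding set_integrable_def set_lebesgue_integral_def
    by (auto simp: has_bochner_integral_iff)
qed

definition laplace :: "(real \<Rightarrow> real) \<Rightarrow> real \<Rightarrow> real" where
  "laplace f l = (LBINT s:{0..}. exp (- (l * s)) * f s)"

text \<open>
  The properties of \<open>t \<mapsto> p t i i\<close> on which the renewal analysis rests.
\<close>
locale return_function =
  fixes f :: "real \<Rightarrow> real"
  assumes cont: "continuous_on {0..} f"
    and nonneg: "\<And>t. 0 \<le> t \<Longrightarrow> 0 \<le> f t"
    and le_one: "\<And>t. 0 \<le> t \<Longrightarrow> f t \<le> 1"
    and at_zero: "f 0 = 1"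
begin

lemma laplace_integrable_from:
  fixes l T :: real
  assumes "0 < l" "0 \<le> T"
  shows "set_integrable lborel {T..} (\<lambda>s. exp (- (l * s)) * f s)"
  unfolding set_integrable_def
proof (rule Bochner_Integration.integrable_bound)
  show "integrable lborel (\<lambda>s. indicator {T..} s *\<^sub>R exp (- (l * s)))"
    using exp_decay_set_integral(1)[OF assms(1), of T] by (simp add: set_integrable_def)
  have "continuous_on {T..} f"
    using cont by (rule continuous_on_subset) (use assms in auto)
  then have "(\<lambda>s. indicator {T..} s *\<^sub>R (exp (- (l * s)) * f s)) \<in> borel_measurable borel"
    by (intro borel_measurable_continuous_on_indicator continuous_intros) auto
  then show "(\<lambda>s. indicator {T..} s *\<^sub>R (exp (- (l * s)) * f s)) \<in> borel_measurable lborel"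
    by simp
  show "AE s in lborel. norm (indicator {T..} s *\<^sub>R (exp (- (l * s)) * f s))
      \<le> norm (indicator {T..} s *\<^sub>R exp (- (l * s)))"
    using assms nonneg le_one by (auto simp: indicator_def abs_mult intro!: AE_I2 mult_left_le)
qed

lemmas laplace_integrable = laplace_integrable_from[OF _ order_refl]

lemma exp_times_continuous: "continuous_on {0..T} (\<lambda>s. exp (- (l * s)) * f s)"
  by (intro continuous_intros continuous_on_subset[OF cont]) auto

lemma laplace_truncated_integrable: "set_integrable lborel {0..T} (\<lambda>s. exp (- (l * s)) * f s)"
  by (rule borel_integrable_atLeastAtMost'[OF exp_times_continuous])

lemma laplace_split:
  assumes "0 < l" "0 \<le> T"
  shows "laplace f l = integral {0..T} (\<lambda>s. exp (- (l * s)) * f s)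
    + (LBINT s:{T..}. exp (- (l * s)) * f s)"
proof -
  have "(LBINT s:{0..}. exp (- (l * s)) * f s) = (LBINT s:{0..T} \<union> {T<..}. exp (- (l * s)) * f s)"
    using assms by (intro arg_cong2[where f="set_lebesgue_integral lborel"]) auto
  also have "\<dots> = (LBINT s:{0..T}. exp (- (l * s)) * f s) + (LBINT s:{T<..}. exp (- (l * s)) * f s)"
    using assms by (intro set_integral_Un laplace_truncated_integrable
        set_integrable_subset[OF laplace_integrable_from[OF assms]]) auto
  also have "(LBINT s:{T<..}. exp (- (l * s)) * f s) = (LBINT s:{T..}. exp (- (l * s)) * f s)"
    unfolding set_lebesgue_integral_def
  proof (rule integral_cong_AE)
    have "set_integrable lborel {T<..} (\<lambda>s. exp (- (l * s)) * f s)"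
      by (rule set_integrable_subset[OF laplace_integrable_from[OF assms]]) auto
    then show "(\<lambda>s. indicator {T<..} s *\<^sub>R (exp (- (l * s)) * f s)) \<in> borel_measurable lborel"
      unfolding set_integrable_def by (rule borel_measurable_integrable)
    show "(\<lambda>s. indicator {T..} s *\<^sub>R (exp (- (l * s)) * f s)) \<in> borel_measurable lborel"
      using laplace_integrable_from[OF assms] unfolding set_integrable_def
      by (rule borel_measurable_integrable)
    show "AE s in lborel. indicator {T<..} s *\<^sub>R (exp (- (l * s)) * f s)
        = indicator {T..} s *\<^sub>R (exp (- (l * s)) * f s)"
      using AE_lborel_singleton[of T] by eventually_elim (auto simp: indicator_def)
  qed
  finally show ?thesis
    using set_borel_integral_eq_integral(2)[OF laplace_truncated_integrable[of T l]]
    by (simp add: laplace_def)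
qed

lemma laplace_tail:
  assumes "0 < l" "0 \<le> T"
  shows "0 \<le> (LBINT s:{T..}. exp (- (l * s)) * f s)"
    and "(LBINT s:{T..}. exp (- (l * s)) * f s) \<le> exp (- (l * T)) / l"
proof -
  show "0 \<le> (LBINT s:{T..}. exp (- (l * s)) * f s)"
    unfolding set_lebesgue_integral_def using assms nonneg
    by (intro integral_nonneg_AE AE_I2) (auto simp: indicator_def)
  have "(LBINT s:{T..}. exp (- (l * s)) * f s) \<le> (LBINT s:{T..}. exp (- (l * s)))"
    using assms nonneg le_one
    by (intro set_integral_mono laplace_integrable_from exp_decay_set_integral) auto
  then show "(LBINT s:{T..}. exp (- (l * s)) * f s) \<le> exp (- (l * T)) / l"
    using exp_decay_set_integral(2)[OF assms(1)] by simp
qed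

lemma truncated_le_laplace:
  assumes "0 < l" "0 \<le> T"
  shows "integral {0..T} (\<lambda>s. exp (- (l * s)) * f s) \<le> laplace f l"
  using laplace_split[OF assms] laplace_tail(1)[OF assms] by simp

lemma laplace_le_inverse: "0 < l \<Longrightarrow> laplace f l \<le> 1 / l"
  using laplace_tail(2)[of l 0] by (simp add: laplace_def)

lemma truncated_tendsto_laplace:
  assumes "0 < l"
  shows "((\<lambda>T. integral {0..T} (\<lambda>s. exp (- (l * s)) * f s)) \<longlongrightarrow> laplace f l) at_top"
proof -
  have "((\<lambda>T. LBINT s:{0..T}. exp (- (l * s)) * f s) \<longlongrightarrow> laplace f l) at_top"
    unfolding laplace_def
    by (intro tendsto_set_lebesgue_integral_at_top laplace_integrable assms) auto
  then show ?thesis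
    by (simp add: set_borel_integral_eq_integral(2)[OF laplace_truncated_integrable])
qed

lemma near_zero:
  assumes "a < 1"
  obtains d where "0 < d" "\<And>s. 0 \<le> s \<Longrightarrow> s \<le> d \<Longrightarrow> a < f s"
proof -
  have "(f \<longlongrightarrow> f 0) (at 0 within {0..})"
    using cont by (simp add: continuous_on)
  then have "eventually (\<lambda>s. a < f s) (at 0 within {0..})"
    using assms at_zero by (intro order_tendstoD(1)) auto
  then obtain d where "0 < d" and d: "\<And>s. s \<in> {0..} \<Longrightarrow> s \<noteq> 0 \<Longrightarrow> dist s 0 < d \<Longrightarrow> a < f s"
    unfolding eventually_at by blast
  show ?thesis
    by (rule that[of "d/2"]) (use \<open>0 < d\<close> d assms at_zero in \<open>force simp: dist_real_def\<close>)+
qed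

lemma laplace_lower_bound:
  assumes "0 < d" "\<And>s. 0 \<le> s \<Longrightarrow> s \<le> d \<Longrightarrow> a \<le> f s" "0 < l"
  shows "a * (1 - exp (- (l * d))) / l \<le> laplace f l"
proof -
  have "((\<lambda>s. exp (- (l * s)) * a) has_integral
      (- (exp (- (l * d)) / l) * a - (- (exp (- (l * 0)) / l) * a))) {0..d}"
    using assms
    by (intro fundamental_theorem_of_calculus)
      (auto intro!: derivative_eq_intros simp: has_real_derivative_iff_has_vector_derivative[symmetric])
  then have "- (exp (- (l * d)) / l) * a - (- (exp (- (l * 0)) / l) * a) \<le> integral {0..d} (\<lambda>s. exp (- (l * s)) * f s)"
    using assms integrable_continuous_interval[OF exp_times_continuous]
    by (intro has_integral_le[OF _ integrable_integral]) auto
  also have "\<dots> \<le> laplace f l"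
    using assms by (intro truncated_le_laplace) auto
  finally show ?thesis by (simp add: diff_divide_distrib right_diff_distrib mult.commute)
qed

lemma laplace_pos:
  assumes "0 < l"
  shows "0 < laplace f l"
proof -
  obtain d where "0 < d" "\<And>s. 0 \<le> s \<Longrightarrow> s \<le> d \<Longrightarrow> 1/2 < f s"
    using near_zero[of "1/2"] by auto
  then have "1/2 * (1 - exp (- (l * d))) / l \<le> laplace f l"
    using assms by (intro laplace_lower_bound) (auto intro: less_imp_le)
  moreover have "0 < 1/2 * (1 - exp (- (l * d))) / l"
    using assms \<open>0 < d\<close> by (auto intro!: divide_pos_pos)
  ultimately show ?thesis by linarith
qed

text \<open>
  On an initial interval where \<open>f\<close> is positive the integrands differ strictly; beyond it they are still ordered.
\<close>
lemma laplace_strict_antimono: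
  assumes "0 < l" "l < k"
  shows "laplace f k < laplace f l"
proof -
  obtain d where d: "0 < d" "\<And>s. 0 \<le> s \<Longrightarrow> s \<le> d \<Longrightarrow> 0 < f s"
    using near_zero[of 0] by auto
  let ?h = "\<lambda>s. exp (- (l * s)) * f s - exp (- (k * s)) * f s"
  have le: "exp (- (k * s)) * f s \<le> exp (- (l * s)) * f s" if "0 \<le> s" for s
    using that assms nonneg[of s] by (intro mult_right_mono) (auto intro: mult_right_mono)
  have c: "continuous_on {0..d} ?h"
    by (intro continuous_intros exp_times_continuous)
  have "?h d \<noteq> 0"
    using d(1) d(2)[of d] assms by auto
  then have "integral {0..d} ?h \<noteq> 0"
    using integral_cbox_eq_0_iff[of 0 d ?h] c le d by auto
  moreover have "integral {0..d} ?h \<ge> 0"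
    using le by (intro Henstock_Kurzweil_Integration.integral_nonneg integrable_continuous_interval c) auto
  ultimately have "integral {0..d} (\<lambda>s. exp (- (k * s)) * f s) < integral {0..d} (\<lambda>s. exp (- (l * s)) * f s)"
    using Henstock_Kurzweil_Integration.integral_diff[OF integrable_continuous_interval[OF exp_times_continuous[of d l]]
        integrable_continuous_interval[OF exp_times_continuous[of d k]]] by simp
  moreover have "(LBINT s:{d..}. exp (- (k * s)) * f s) \<le> (LBINT s:{d..}. exp (- (l * s)) * f s)"
    using d assms le by (intro set_integral_mono laplace_integrable_from) auto
  ultimately show ?thesis
    using laplace_split[of l d] laplace_split[of k d] assms d by linarith
qed

lemma laplace_antimono: "0 < l \<Longrightarrow> l \<le> k \<Longrightarrow> laplace f k \<le> laplace f l"
  using laplace_strict_antimono[of l k] by (cases "l = k") auto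

text \<open>
  As \<open>l\<close> grows, the weight \<open>l * exp (- l * s)\<close> concentrates its unit mass at \<open>0\<close>, where \<open>f\<close> equals \<open>1\<close>.
\<close>
lemma times_laplace_tendsto_one: "((\<lambda>l. l * laplace f l) \<longlongrightarrow> 1) at_top"
proof (rule order_tendstoI)
  fix a :: real assume "a < 1"
  then obtain b where b: "a < b" "b < 1" using dense by blast
  obtain d where d: "0 < d" "\<And>s. 0 \<le> s \<Longrightarrow> s \<le> d \<Longrightarrow> b < f s"
    using near_zero[OF b(2)] by auto
  have "((\<lambda>l. b * (1 - exp (- (l * d)))) \<longlongrightarrow> b) at_top"
    using d(1) by real_asymp
  then have "eventually (\<lambda>l. a < b * (1 - exp (- (l * d)))) at_top"
    using b by (intro order_tendstoD(1)) auto
  then show "eventually (\<lambda>l. a < l * laplace f l) at_top"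
    using eventually_gt_at_top[of 0]
  proof eventually_elim
    case (elim l)
    have "b * (1 - exp (- (l * d))) / l \<le> laplace f l"
      using d elim by (intro laplace_lower_bound) (auto intro: less_imp_le)
    then show ?case using elim by (simp add: field_simps)
  qed
next
  fix a :: real assume "1 < a"
  show "eventually (\<lambda>l. l * laplace f l < a) at_top"
    using eventually_gt_at_top[of 0]
  proof eventually_elim
    case (elim l)
    then show ?case using laplace_le_inverse[of l] \<open>1 < a\<close> by (simp add: field_simps)
  qed
qed

definition total_mass :: ennreal where
  "total_mass = (\<integral>\<^sup>+ s\<in>{0..}. ennreal (f s) \<partial>lborel)"

lemma laplace_nn_integral:
  assumes "0 < l"
  shows "ennreal (laplace f l) = (\<integral>\<^sup>+ s\<in>{0..}. ennreal (exp (- (l * s)) * f s) \<partial>lborel)"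
proof -
  have "ennreal (laplace f l) = (\<integral>\<^sup>+s. ennreal (indicator {0..} s *\<^sub>R (exp (- (l * s)) * f s)) \<partial>lborel)"
    unfolding laplace_def set_lebesgue_integral_def
    using laplace_integrable[OF assms] nonneg
    by (intro nn_integral_eq_integral[symmetric] AE_I2) (auto simp: set_integrable_def indicator_def)
  also have "\<dots> = (\<integral>\<^sup>+ s\<in>{0..}. ennreal (exp (- (l * s)) * f s) \<partial>lborel)"
    by (intro nn_integral_cong) (auto simp: indicator_def)
  finally show ?thesis .
qed

lemma laplace_le_total_mass:
  assumes "0 < l"
  shows "ennreal (laplace f l) \<le> total_mass"
  unfolding laplace_nn_integral[OF assms] total_mass_def
proof (intro nn_integral_mono)
  fix s :: real
  show "ennreal (exp (- (l * s)) * f s) * indicator {0..} s \<le> ennreal (f s) * indicator {0..} s"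
    using assms nonneg[of s] by (auto simp: indicator_def intro!: ennreal_leI mult_left_le_one_le)
qed

text \<open>
  Monotone convergence along \<open>l = 1 / (n + 1)\<close>. For a return function the total mass is the
  Green function, so this is what links the Laplace transform to the threshold.
\<close>
lemma total_mass_eq_SUP_laplace: "total_mass = (SUP n. ennreal (laplace f (1 / real (Suc n))))"
proof -
  let ?g = "\<lambda>n s. ennreal (exp (- (1 / real (Suc n) * s)) * f s) * indicator {0..} s"
  have meas: "?g n \<in> borel_measurable lborel" for n
  proof -
    have "(\<lambda>s. ennreal (indicator {0..} s *\<^sub>R (exp (- (1 / real (Suc n) * s)) * f s))) \<in> borel_measurable lborel"
      using laplace_integrable[of "1 / real (Suc n)"] by (auto simp: set_integrable_def)
    also have "(\<lambda>s. ennreal (indicator {0..} s *\<^sub>R (exp (- (1 / real (Suc n) * s)) * f s))) = ?g n"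
      by (auto simp: indicator_def)
    finally show ?thesis .
  qed
  have inc: "incseq ?g"
  proof (intro incseq_SucI le_funI)
    fix n s
    show "?g n s \<le> ?g (Suc n) s"
    proof (cases "0 \<le> s")
      case True
      then have "1 / real (Suc (Suc n)) * s \<le> 1 / real (Suc n) * s"
        by (intro mult_right_mono) (auto simp: field_simps)
      then show ?thesis using nonneg[OF True]
        by (auto simp: indicator_def intro!: ennreal_leI mult_right_mono)
    qed (auto simp: indicator_def)
  qed
  have sup: "(SUP n. ?g n s) = ennreal (f s) * indicator {0..} s" for s
  proof (rule LIMSEQ_unique[OF LIMSEQ_SUP])
    show "incseq (\<lambda>n. ?g n s)" using inc by (auto simp: incseq_def le_fun_def)
    have "(\<lambda>n. exp (- (1 / real (Suc n) * s)) * f s) \<longlonglongrightarrow> exp (- (0 * s)) * f s"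
      by (intro tendsto_intros LIMSEQ_Suc lim_1_over_n)
    then show "(\<lambda>n. ?g n s) \<longlonglongrightarrow> ennreal (f s) * indicator {0..} s"
      by (auto simp: indicator_def intro!: tendsto_ennrealI)
  qed
  have "total_mass = (\<integral>\<^sup>+ s. (SUP n. ?g n s) \<partial>lborel)"
    by (simp only: total_mass_def sup)
  also have "\<dots> = (SUP n. \<integral>\<^sup>+ s. ?g n s \<partial>lborel)"
    using inc meas by (rule nn_integral_monotone_convergence_SUP)
  finally show ?thesis by (simp add: laplace_nn_integral)
qed

end

section \<open>Analytic continuation of the Laplace transform\<close>

lemma set_integral_mono_subset:
  fixes h :: "real \<Rightarrow> real"
  assumes "set_integrable lborel B h" "A \<in> sets borel" "A \<subseteq> B" "\<And>x. x \<in> B \<Longrightarrow> 0 \<le> h x"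
  shows "(LBINT x:A. h x) \<le> (LBINT x:B. h x)"
  unfolding set_lebesgue_integral_def
proof (intro integral_mono)
  show "integrable lborel (\<lambda>x. indicator A x *\<^sub>R h x)"
    using set_integrable_subset[OF assms(1)] assms(2,3) by (simp add: set_integrable_def)
  show "integrable lborel (\<lambda>x. indicator B x *\<^sub>R h x)"
    using assms(1) by (simp add: set_integrable_def)
qed (use assms in \<open>auto simp: indicator_def\<close>)

context return_function
begin

definition complex_laplace :: "complex \<Rightarrow> complex" where
  "complex_laplace z = (LBINT s:{0..}. exp (- (z * of_real s)) * of_real (f s))"

lemma complex_laplace_of_real: "complex_laplace (of_real l) = of_real (laplace f l)"
proof -
  have "complex_laplace (of_real l) = (LBINT s:{0..}. complex_of_real (exp (- (l * s)) * f s))"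
    unfolding complex_laplace_def by (intro set_lebesgue_integral_cong) (auto simp: exp_of_real[symmetric])
  also have "\<dots> = of_real (laplace f l)"
    unfolding laplace_def by (rule set_integral_complex_of_real)
  finally show ?thesis .
qed

lemma complex_laplace_integrable:
  assumes "0 < Re z"
  shows "set_integrable lborel {0..} (\<lambda>s. exp (- (z * of_real s)) * of_real (f s))"
  unfolding set_integrable_def
proof (rule Bochner_Integration.integrable_bound)
  show "integrable lborel (\<lambda>s. indicator {0..} s *\<^sub>R exp (- (Re z * s)))"
    using exp_decay_set_integral(1)[OF assms, of 0] by (simp add: set_integrable_def)
  have "(\<lambda>s. indicator {0..} s *\<^sub>R (exp (- (z * of_real s)) * of_real (f s))) \<in> borel_measurable borel"
    by (intro borel_measurable_continuous_on_indicator continuous_intros cont) auto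
  then show "(\<lambda>s. indicator {0..} s *\<^sub>R (exp (- (z * of_real s)) * of_real (f s))) \<in> borel_measurable lborel"
    by simp
  show "AE s in lborel. norm (indicator {0..} s *\<^sub>R (exp (- (z * of_real s)) * of_real (f s)))
      \<le> norm (indicator {0..} s *\<^sub>R exp (- (Re z * s)))"
    using nonneg le_one by (auto simp: indicator_def norm_mult intro!: AE_I2 mult_left_le)
qed

lemma complex_laplace_truncation_error:
  assumes "0 < d" "d \<le> Re z" "0 \<le> T"
  shows "norm (complex_laplace z - integral {0..T} (\<lambda>s. exp (- (z * of_real s)) * of_real (f s)))
    \<le> exp (- (d * T)) / d"
proof -
  let ?k = "\<lambda>s. exp (- (z * of_real s)) * of_real (f s)"
  have int: "set_integrable lborel {0..} ?k"
    using assms by (intro complex_laplace_integrable) auto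
  have int2: "set_integrable lborel {T<..} ?k" "set_integrable lborel {0..T} ?k"
    by (rule set_integrable_subset[OF int]; use assms in auto)+
  have "complex_laplace z = (LBINT s:{0..T} \<union> {T<..}. ?k s)"
    unfolding complex_laplace_def
    using assms by (intro arg_cong2[where f="set_lebesgue_integral lborel"]) auto
  also have "\<dots> = (LBINT s:{0..T}. ?k s) + (LBINT s:{T<..}. ?k s)"
    by (intro set_integral_Un int2) auto
  also have "(LBINT s:{0..T}. ?k s) = integral {0..T} ?k"
    by (rule set_borel_integral_eq_integral(2)[OF int2(2)])
  finally have "norm (complex_laplace z - integral {0..T} ?k) = norm (LBINT s:{T<..}. ?k s)"
    by simp
  also have "\<dots> \<le> (LBINT s:{T<..}. norm (?k s))"
    by (rule set_integral_norm_bound[OF int2(1)])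
  also have "\<dots> \<le> (LBINT s:{T..}. exp (- (d * s)))"
    unfolding set_lebesgue_integral_def
  proof (intro integral_mono)
    show "integrable lborel (\<lambda>s. indicator {T<..} s *\<^sub>R norm (?k s))"
      using set_integrable_norm[OF int2(1)] by (simp add: set_integrable_def)
    show "integrable lborel (\<lambda>s. indicator {T..} s *\<^sub>R exp (- (d * s)))"
      using exp_decay_set_integral(1)[OF assms(1), of T] by (simp add: set_integrable_def)
    fix s :: real
    have "exp (- (Re z * s)) * f s \<le> exp (- (d * s)) * 1" if "T < s"
      using that assms nonneg[of s] le_one[of s]
      by (intro mult_mono) (auto intro!: mult_right_mono)
    then show "indicator {T<..} s *\<^sub>R norm (?k s) \<le> indicator {T..} s *\<^sub>R exp (- (d * s))"
      using nonneg[of s] assms by (auto simp: indicator_def norm_mult)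
  qed
  also have "\<dots> = exp (- (d * T)) / d"
    by (rule exp_decay_set_integral(2)[OF assms(1)])
  finally show ?thesis .
qed

text \<open>
  The truncated transforms are holomorphic by differentiation under the integral, and
  they converge uniformly on closed discs in the open right half-plane.
\<close>
lemma complex_laplace_holomorphic: "complex_laplace holomorphic_on {z. 0 < Re z}"
proof (rule holomorphic_uniform_sequence)
  show "open {z. 0 < Re z}" by (rule open_halfspace_Re_gt)
  let ?F = "\<lambda>n z. integral (cbox 0 (real n)) (\<lambda>s. exp (- (z * of_real s)) * of_real (f s))"
  have cf: "continuous_on {0..real n} f" for n
    by (rule continuous_on_subset[OF cont]) auto
  show "?F n holomorphic_on {z. 0 < Re z}" for n
  proof (rule leibniz_rule_holomorphic)
    show "((\<lambda>z. exp (- (z * of_real s)) * of_real (f s)) has_field_derivative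
        - of_real s * exp (- (z * of_real s)) * of_real (f s)) (at z within {z. 0 < Re z})" for z s
      by (auto intro!: derivative_eq_intros)
    show "(\<lambda>s. exp (- (z * of_real s)) * of_real (f s)) integrable_on cbox 0 (real n)" for z :: complex
      using cf[of n] by (auto intro!: integrable_continuous_interval continuous_intros)
    show "continuous_on ({z. 0 < Re z} \<times> cbox 0 (real n))
        (\<lambda>(z, s). - of_real s * exp (- (z * of_real s)) * of_real (f s))"
    proof -
      have "continuous_on ({z. 0 < Re z} \<times> cbox 0 (real n)) (\<lambda>x. f (snd x))"
        by (rule continuous_on_compose2[OF cf[of n]]) (auto intro!: continuous_intros)
      then show ?thesis
        unfolding case_prod_unfold by (intro continuous_intros)
    qed
    show "convex {z. 0 < Re z}" by (rule convex_halfspace_Re_gt)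
  qed
  fix x assume "x \<in> {z. 0 < Re z}"
  define d where "d = Re x / 2"
  have d: "0 < d" using \<open>x \<in> _\<close> by (simp add: d_def)
  have ball: "d \<le> Re z" if "z \<in> cball x d" for z
  proof -
    have "Re x - Re z \<le> norm (x - z)" by (metis complex_Re_le_cmod minus_complex.simps(1))
    then show ?thesis using that by (simp add: d_def dist_norm)
  qed
  have "uniform_limit (cball x d) ?F complex_laplace sequentially"
  proof (rule uniform_limitI)
    fix e :: real assume "0 < e"
    have "((\<lambda>n. exp (- (d * real n)) / d) \<longlongrightarrow> 0) sequentially"
      using d by real_asymp
    then have "eventually (\<lambda>n. exp (- (d * real n)) / d < e) sequentially"
      using \<open>0 < e\<close> by (rule order_tendstoD)
    then show "\<forall>\<^sub>F n in sequentially. \<forall>z\<in>cball x d. dist (?F n z) (complex_laplace z) < e"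
    proof eventually_elim
      case (elim n)
      show ?case
      proof
        fix z assume "z \<in> cball x d"
        then have "norm (complex_laplace z - ?F n z) \<le> exp (- (d * real n)) / d"
          using complex_laplace_truncation_error[OF d ball, of z "real n"] by simp
        with elim show "dist (?F n z) (complex_laplace z) < e"
          by (simp add: dist_norm norm_minus_commute)
      qed
    qed
  qed
  moreover have "cball x d \<subseteq> {z. 0 < Re z}" using ball d by force
  ultimately show "\<exists>d>0. cball x d \<subseteq> {z. 0 < Re z} \<and> uniform_limit (cball x d) ?F complex_laplace sequentially"
    using d by blast
qed

text \<open>
  The identity theorem for holomorphic functions on the right half-plane, applied to
  \<open>complex_laplace z * (z - b) - a\<close>, which vanishes on a real interval.
\<close>
lemma laplace_identity_extends:
  assumes "0 < p" "p < q"
    and id: "\<And>l. p < l \<Longrightarrow> l < q \<Longrightarrow> laplace f l * (l - b) = a"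
    and "0 < l"
  shows "laplace f l * (l - b) = a"
proof -
  let ?k = "\<lambda>z. complex_laplace z * (z - of_real b) - of_real a"
  have "?k (of_real l) = 0"
  proof (rule analytic_continuation[where f = ?k and S = "{z. 0 < Re z}" and U = "of_real ` {p<..<q}"
        and \<xi> = "of_real ((p + q) / 2)" and w = "of_real l"])
    show "?k holomorphic_on {z. 0 < Re z}"
      by (intro holomorphic_intros complex_laplace_holomorphic)
    show "open {z. 0 < Re z}" by (rule open_halfspace_Re_gt)
    show "connected {z. 0 < Re z}" by (intro convex_connected convex_halfspace_Re_gt)
    show "of_real ` {p<..<q} \<subseteq> {z. 0 < Re z}" using assms by auto
    show "of_real ((p + q) / 2) \<in> {z. 0 < Re z}" using assms by auto
    have "(p + q) / 2 islimpt {p<..<q}"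
      using assms by (intro interior_limit_point) (simp add: interior_open)
    then show "of_real ((p + q) / 2) islimpt (of_real ` {p<..<q} :: complex set)"
      by (rule islimpt_isCont_image) (simp_all only: of_real_eq_iff eventually_neq_at_within isCont_of_real continuous_ident)
    fix z :: complex assume "z \<in> of_real ` {p<..<q}"
    then obtain x where "p < x" "x < q" "z = of_real x" by auto
    moreover have "complex_of_real (laplace f x * (x - b)) = of_real a"
      using id[OF calculation(1,2)] by simp
    ultimately show "?k z = 0" by (simp add: complex_laplace_of_real)
  qed (use assms in auto)
  then have "complex_of_real (laplace f l * (l - b)) = of_real a"
    by (simp add: complex_laplace_of_real)
  then show ?thesis by (simp only: of_real_eq_iff)
qed

text \<open>
  The slope is forced because \<open>l * laplace f l\<close> tends to \<open>1\<close>; a positive zero \<open>b\<close> would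
  make the left-hand side of the identity vanish at \<open>l = b\<close>.
\<close>
lemma laplace_reciprocal_affine:
  assumes "0 < p" "p < q"
    and id: "\<And>l. p < l \<Longrightarrow> l < q \<Longrightarrow> laplace f l * (l - b) = a"
  shows "b \<le> 0" and "\<And>l. 0 < l \<Longrightarrow> laplace f l * (l - b) = 1"
proof -
  have all: "laplace f l * (l - b) = a" if "0 < l" for l
    using laplace_identity_extends[OF assms that] .
  have "((\<lambda>l. (l * laplace f l) * ((l - b) / l)) \<longlongrightarrow> 1 * 1) at_top"
  proof (intro tendsto_mult times_laplace_tendsto_one)
    show "((\<lambda>l. (l - b) / l) \<longlongrightarrow> 1) at_top" by real_asymp
  qed
  moreover have "eventually (\<lambda>l. (l * laplace f l) * ((l - b) / l) = a) at_top"
    using eventually_gt_at_top[of 0]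
  proof eventually_elim
    case (elim l)
    have "(l * laplace f l) * ((l - b) / l) = laplace f l * (l - b)" using elim by simp
    then show ?case using all[OF elim] by simp
  qed
  ultimately have "((\<lambda>l::real. a) \<longlongrightarrow> 1 * 1) at_top"
    by (rule Lim_transform_eventually)
  then have a: "a = 1"
    by (simp add: tendsto_const_iff)
  show "laplace f l * (l - b) = 1" if "0 < l" for l using all[OF that] a by simp
  show "b \<le> 0" using all[of b] a by fastforce
qed

end

section \<open>Supermultiplicative functions with the Laplace transform of an exponential\<close>

context return_function
begin

text \<open>
  A supermultiplicative function that falls below \<open>exp (- c * t)\<close> at one time \<open>t\<close> does so near \<open>0\<close>, with a
  larger constant \<open>e > c\<close>: otherwise \<open>f t \<ge> f s ^ n * f (t - n * s)\<close> with a small step \<open>s\<close> would be too large.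
  Then \<open>laplace f l\<close> is at most \<open>1 / (l + e)\<close> up to an exponentially small error, which is
  less than \<open>1 / (l + c)\<close> for large \<open>l\<close>.
\<close>
lemma exponential_lower_bound:
  assumes super: "\<And>s t. 0 \<le> s \<Longrightarrow> 0 \<le> t \<Longrightarrow> f s * f t \<le> f (s + t)"
    and lap: "\<And>l. 0 < l \<Longrightarrow> laplace f l * (l + c) = 1"
    and "0 \<le> c" "0 \<le> t"
  shows "exp (- (c * t)) \<le> f t"
proof (rule ccontr)
  assume "\<not> exp (- (c * t)) \<le> f t"
  then have lt: "f t < exp (- (c * t))" by simp
  then have "0 < t" using at_zero \<open>0 \<le> t\<close> by (cases "t = 0") auto
  have "((\<lambda>c. exp (- (c * t))) \<longlongrightarrow> exp (- (c * t))) (at_right c)"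
    by (intro tendsto_intros)
  then have "eventually (\<lambda>c. f t < exp (- (c * t))) (at_right c)"
    using lt by (rule order_tendstoD)
  then obtain k where k: "c < k" "f t < exp (- (k * t))"
    unfolding eventually_at_right_field by (metis dense)
  \<comment> \<open>The gap between \<open>e\<close> and \<open>k\<close> absorbs the remainder of the division of \<open>t\<close> by a small step.\<close>
  define e where "e = (c + k) / 2"
  have e: "c < e" "e < k" using k by (auto simp: e_def)
  have "exp (- ((k - e) * t)) < 1" using e \<open>0 < t\<close> by simp
  then obtain d where d: "0 < d" "\<And>s. 0 \<le> s \<Longrightarrow> s \<le> d \<Longrightarrow> exp (- ((k - e) * t)) < f s"
    using near_zero by blast
  have pow: "f s ^ n \<le> f (real n * s)" if "0 \<le> s" for s n
  proof (induction n)
    case 0 then show ?case by (simp add: at_zero)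
  next
    case (Suc n)
    have "f s ^ Suc n \<le> f s * f (real n * s)"
      using Suc nonneg[OF that] by (auto intro: mult_left_mono)
    also have "\<dots> \<le> f (s + real n * s)" using that by (intro super) auto
    finally show ?case by (simp add: algebra_simps)
  qed
  have small: "f s \<le> exp (- (e * s))" if "0 \<le> s" "s \<le> d" for s
  proof (rule ccontr)
    assume "\<not> f s \<le> exp (- (e * s))"
    then have gt: "exp (- (e * s)) < f s" by simp
    then have "0 < s" using that at_zero by (cases "s = 0") auto
    define n where "n = nat \<lfloor>t / s\<rfloor>"
    have n: "real n * s \<le> t" "t < real n * s + s"
    proof -
      have "real n = of_int \<lfloor>t / s\<rfloor>" using \<open>0 < s\<close> \<open>0 \<le> t\<close> by (simp add: n_def)
      then have "real n \<le> t / s" "t / s < real n + 1" by linarith+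
      then show "real n * s \<le> t" "t < real n * s + s" using \<open>0 < s\<close> by (auto simp: field_simps)
    qed
    have "exp (- (k * t)) = exp (- (e * t)) * exp (- ((k - e) * t))"
      unfolding exp_add[symmetric] by (simp add: algebra_simps)
    also have "\<dots> \<le> exp (- (e * (real n * s))) * f (t - real n * s)"
      using n that e \<open>0 \<le> c\<close> d(2)[of "t - real n * s"]
      by (intro mult_mono) (auto intro!: mult_left_mono less_imp_le)
    also have "exp (- (e * (real n * s))) = exp (- (e * s)) ^ n"
      by (simp add: exp_of_nat_mult[symmetric] algebra_simps)
    also have "exp (- (e * s)) ^ n * f (t - real n * s) \<le> f s ^ n * f (t - real n * s)"
      using gt n nonneg by (intro mult_right_mono power_mono) auto
    also have "\<dots> \<le> f (real n * s) * f (t - real n * s)"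
      using that n nonneg pow by (intro mult_right_mono) auto
    also have "\<dots> \<le> f (real n * s + (t - real n * s))"
      using that n by (intro super) auto
    finally show False using k by simp
  qed
  have upper: "laplace f l \<le> 1 / (l + e) + exp (- (l * d)) / l" if "0 < l" for l
  proof -
    have le: "0 < l + e" using that e \<open>0 \<le> c\<close> by simp
    have "integral {0..d} (\<lambda>s. exp (- (l * s)) * f s) \<le> integral {0..d} (\<lambda>s. exp (- ((l + e) * s)))"
    proof (intro integral_le integrable_continuous_interval exp_times_continuous)
      fix s assume "s \<in> {0..d}"
      then have "exp (- (l * s)) * f s \<le> exp (- (l * s)) * exp (- (e * s))"
        by (intro mult_left_mono small) auto
      then show "exp (- (l * s)) * f s \<le> exp (- ((l + e) * s))"
        unfolding exp_add[symmetric] by (simp add: algebra_simps)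
    qed (auto intro!: continuous_intros)
    also have "\<dots> = (LBINT s:{0..d}. exp (- ((l + e) * s)))"
      by (intro set_borel_integral_eq_integral(2)[symmetric] borel_integrable_atLeastAtMost' continuous_intros)
    also have "\<dots> \<le> (LBINT s:{0..}. exp (- ((l + e) * s)))"
      using exp_decay_set_integral(1)[OF le, of 0] d
      by (intro set_integral_mono_subset) auto
    also have "\<dots> = 1 / (l + e)" using exp_decay_set_integral(2)[OF le, of 0] by simp
    finally show ?thesis
      using laplace_split[of l d] laplace_tail(2)[of l d] that d by linarith
  qed
  have "((\<lambda>l. l * (l + c) * (1 / (l + e) + exp (- (l * d)) / l) - l) \<longlongrightarrow> c - e) at_top"
    using d(1) by real_asymp
  then have "eventually (\<lambda>l. l * (l + c) * (1 / (l + e) + exp (- (l * d)) / l) - l < 0) at_top"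
    using e by (intro order_tendstoD) auto
  then have "eventually (\<lambda>l::real. False) at_top"
    using eventually_gt_at_top[of 0]
  proof eventually_elim
    case (elim l)
    have "l * (l + c) * laplace f l \<le> l * (l + c) * (1 / (l + e) + exp (- (l * d)) / l)"
      using elim \<open>0 \<le> c\<close> by (intro mult_left_mono upper) auto
    moreover have "l * (l + c) * laplace f l = l"
      using lap[of l] elim by (simp add: mult_ac)
    ultimately show False using elim by linarith
  qed
  then show False by simp
qed

text \<open>
  The continuous function \<open>f t - exp (- c * t)\<close> is nonnegative by the lower bound, so it vanishes as soon
  as its Laplace transform has a zero; the transform is zero at \<open>1\<close>.
\<close>
lemma exponential_of_laplace:
  assumes super: "\<And>s t. 0 \<le> s \<Longrightarrow> 0 \<le> t \<Longrightarrow> f s * f t \<le> f (s + t)"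
    and lap: "\<And>l. 0 < l \<Longrightarrow> laplace f l * (l + c) = 1"
    and "0 \<le> c" "0 \<le> t"
  shows "f t = exp (- (c * t))"
proof -
  have lower: "exp (- (c * s)) \<le> f s" if "0 \<le> s" for s
    using exponential_lower_bound[OF super lap \<open>0 \<le> c\<close> that] .
  let ?h = "\<lambda>s. exp (- (1 * s)) * f s - exp (- ((1 + c) * s))"
  have pos: "0 \<le> ?h s" if "0 \<le> s" for s
  proof -
    have "exp (- (1 * s)) * exp (- (c * s)) \<le> exp (- (1 * s)) * f s"
      using lower that by (intro mult_left_mono) auto
    then show ?thesis unfolding exp_add[symmetric] by (simp add: algebra_simps)
  qed
  have int: "set_integrable lborel {0..} ?h"
    using \<open>0 \<le> c\<close> by (intro set_integral_diff(1) laplace_integrable exp_decay_set_integral(1)) auto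
  have "(LBINT s:{0..}. ?h s) = laplace f 1 - 1 / (1 + c)"
    using \<open>0 \<le> c\<close> exp_decay_set_integral[of "1 + c" 0] laplace_integrable[of 1]
    by (subst set_integral_diff(2)) (auto simp: laplace_def)
  also have "\<dots> = 0" using lap[of 1] \<open>0 \<le> c\<close> by (simp add: field_simps)
  finally have zero: "(LBINT s:{0..}. ?h s) = 0" .
  have c: "continuous_on {0..t + 1} ?h"
    by (intro continuous_intros exp_times_continuous)
  have "integral {0..t + 1} ?h = (LBINT s:{0..t + 1}. ?h s)"
    by (intro set_borel_integral_eq_integral(2)[symmetric] borel_integrable_atLeastAtMost' c)
  also have "\<dots> \<le> (LBINT s:{0..}. ?h s)"
    using int pos by (intro set_integral_mono_subset) auto
  finally have "integral {0..t + 1} ?h \<le> 0" using zero by simp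
  moreover have "0 \<le> integral {0..t + 1} ?h"
    using pos by (intro Henstock_Kurzweil_Integration.integral_nonneg integrable_continuous_interval c) auto
  ultimately have "integral (cbox 0 (t + 1)) ?h = 0" by (simp only: cbox_interval)
  moreover have "integral (cbox 0 (t + 1)) ?h = 0 \<longleftrightarrow> (\<forall>s\<in>cbox 0 (t + 1). ?h s = 0)"
  proof (rule integral_cbox_eq_0_iff)
    show "continuous_on (cbox 0 (t + 1)) ?h" using c by (simp only: cbox_interval)
    show "box 0 (t + 1) \<noteq> {}" using \<open>0 \<le> t\<close> by simp
    show "0 \<le> ?h s" if "s \<in> cbox 0 (t + 1)" for s using that by (intro pos) simp
  qed
  moreover have "t \<in> cbox 0 (t + 1)" using \<open>0 \<le> t\<close> by simp
  ultimately have "?h t = 0" by blast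
  then have "exp (- (1 * t)) * f t = exp (- ((1 + c) * t))" by (rule iffD1[OF right_minus_eq])
  also have "- ((1 + c) * t) = - (1 * t) + - (c * t)" by (simp add: algebra_simps)
  finally have "exp (- (1 * t)) * f t = exp (- (1 * t)) * exp (- (c * t))"
    by (simp only: exp_add)
  then show ?thesis by simp
qed

end

section \<open>Exponential growth of solutions of the renewal equation\<close>

locale renewal_equation = return_function f
  for f :: "real \<Rightarrow> real" +
  fixes g :: real and m :: "real \<Rightarrow> real"
  assumes weight_nonneg: "0 \<le> g"
    and solution_cont: "continuous_on {0..} m"
    and solution_mono: "\<And>s t. 0 \<le> s \<Longrightarrow> s \<le> t \<Longrightarrow> m s \<le> m t"
    and solution_ge_one: "\<And>t. 0 \<le> t \<Longrightarrow> 1 \<le> m t"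
    and renewal: "\<And>t. 0 \<le> t \<Longrightarrow> m t = 1 + g * integral {0..t} (\<lambda>s. f s * m (t - s))"
begin

lemma convolution_integrand_cont:
  assumes "0 \<le> T" "T \<le> t"
  shows "continuous_on {0..T} (\<lambda>s. f s * m (t - s))"
  using assms
  by (intro continuous_intros continuous_on_subset[OF cont]
      continuous_on_compose2[OF solution_cont]) auto

text \<open>
  With \<open>h s = exp (- l * s) * m s\<close>, the renewal equation at a maximum \<open>u\<close> of \<open>h\<close> on \<open>{0..t}\<close> reads
  \<open>h u \<le> 1 + h u * (g * laplace f l)\<close>.
\<close>
lemma solution_upper_bound:
  assumes "0 < l" "g * laplace f l < 1" "0 \<le> t"
  shows "m t \<le> exp (l * t) / (1 - g * laplace f l)"
proof -
  let ?h = "\<lambda>s. exp (- (l * s)) * m s"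
  have "continuous_on {0..t} ?h"
    by (intro continuous_intros continuous_on_subset[OF solution_cont]) auto
  then obtain u where u: "u \<in> {0..t}" and max: "\<And>s. s \<in> {0..t} \<Longrightarrow> ?h s \<le> ?h u"
    using continuous_attains_sup[of "{0..t}" ?h] assms(3) by auto
  have pos: "0 \<le> ?h u" using solution_ge_one[of u] u by auto
  have pt: "f s * m (u - s) \<le> exp (l * u) * ?h u * (exp (- (l * s)) * f s)" if "s \<in> {0..u}" for s
  proof -
    have "exp (l * u) * exp (- (l * s)) * exp (- (l * (u - s))) = exp (l * u + - (l * s) + - (l * (u - s)))"
      by (simp only: exp_add)
    also have "\<dots> = 1" by (simp add: right_diff_distrib)
    finally have "m (u - s) = exp (l * u) * exp (- (l * s)) * ?h (u - s)"
      by (simp add: mult.assoc[symmetric])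
    also have "\<dots> \<le> exp (l * u) * exp (- (l * s)) * ?h u"
      using that u by (intro mult_left_mono max) auto
    finally have "m (u - s) \<le> exp (l * u) * exp (- (l * s)) * ?h u" .
    then have "f s * m (u - s) \<le> f s * (exp (l * u) * exp (- (l * s)) * ?h u)"
      using that nonneg by (intro mult_left_mono) auto
    also have "\<dots> = exp (l * u) * ?h u * (exp (- (l * s)) * f s)"
      by (simp only: mult_ac)
    finally show ?thesis .
  qed
  have "integral {0..u} (\<lambda>s. f s * m (u - s)) \<le> integral {0..u} (\<lambda>s. exp (l * u) * ?h u * (exp (- (l * s)) * f s))"
    using u by (intro integral_le integrable_continuous_interval convolution_integrand_cont
        continuous_on_mult[OF continuous_on_const exp_times_continuous] pt) auto
  also have "\<dots> = exp (l * u) * ?h u * integral {0..u} (\<lambda>s. exp (- (l * s)) * f s)"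
    by simp
  also have "\<dots> \<le> exp (l * u) * ?h u * laplace f l"
    using u assms pos by (intro mult_left_mono truncated_le_laplace) auto
  finally have "m u \<le> 1 + g * (exp (l * u) * ?h u * laplace f l)"
    using renewal[of u] u weight_nonneg by (auto intro: mult_left_mono)
  then have "?h u \<le> exp (- (l * u)) * (1 + g * (exp (l * u) * ?h u * laplace f l))"
    by (intro mult_left_mono) auto
  also have "\<dots> = exp (- (l * u)) + (exp (- (l * u)) * exp (l * u)) * (?h u * (g * laplace f l))"
    by (simp add: algebra_simps)
  also have "\<dots> = exp (- (l * u)) + ?h u * (g * laplace f l)"
    by (simp add: exp_add[symmetric])
  also have "\<dots> \<le> 1 + ?h u * (g * laplace f l)" using u assms by auto
  finally have "?h u * (1 - g * laplace f l) \<le> 1" by (simp add: algebra_simps)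
  then have "?h u \<le> 1 / (1 - g * laplace f l)"
    using assms by (simp add: field_simps)
  with max[of t] assms(3) have "?h t \<le> 1 / (1 - g * laplace f l)" by simp
  then have "exp (l * t) * ?h t \<le> exp (l * t) * (1 / (1 - g * laplace f l))"
    by (intro mult_left_mono) auto
  also have "exp (l * t) * ?h t = m t"
    by (simp add: exp_add[symmetric] mult.assoc[symmetric])
  finally show ?thesis by simp
qed

text \<open>
  By the assumption on the mass up to \<open>T\<close>, the function \<open>exp (l * (t - T))\<close> is a subsolution of the
  renewal equation for \<open>t \<ge> T\<close>, and it lies below \<open>1 \<le> m t\<close> for \<open>t \<le> T\<close>; the comparison then holds for all times.
\<close>
lemma solution_lower_bound:
  assumes "0 \<le> l" "0 \<le> T" and mass: "1 \<le> g * integral {0..T} (\<lambda>s. exp (- (l * s)) * f s)"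
    and "0 \<le> t"
  shows "exp (l * (t - T)) \<le> m t"
proof (rule ccontr)
  assume neg: "\<not> exp (l * (t - T)) \<le> m t"
  define B where "B = {s. 0 \<le> s \<and> m s < exp (l * (s - T))}"
  have B: "t \<in> B" "bdd_below B" using neg assms by (auto simp: B_def)
  define u where "u = Inf B"
  have before: "exp (l * (s - T)) \<le> m s" if "0 \<le> s" "s < u" for s
    using that cInf_lower[OF _ B(2), of s] by (force simp: B_def u_def)
  have "T \<le> s" if "s \<in> B" for s
  proof (rule ccontr)
    assume "\<not> T \<le> s"
    then have "l * (s - T) \<le> 0" using assms by (simp add: mult_nonneg_nonpos)
    then have "exp (l * (s - T)) \<le> 1" by (simp only: exp_le_one_iff)
    moreover have "0 \<le> s" "m s < exp (l * (s - T))" using that by (auto simp: B_def)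
    ultimately show False using solution_ge_one[of s] by linarith
  qed
  then have "T \<le> u" unfolding u_def using B by (intro cInf_greatest) auto
  then have "0 \<le> u" using assms by simp
  \<comment> \<open>At the first failure \<open>u\<close> the renewal equation gives the bound with the constant \<open>1\<close> to spare;
    as \<open>m\<close> is monotone and the exponential continuous, it cannot fail immediately after \<open>u\<close>.\<close>
  have "exp (l * (u - T)) * 1 \<le> exp (l * (u - T)) * (g * integral {0..T} (\<lambda>s. exp (- (l * s)) * f s))"
    using mass by (intro mult_left_mono) auto
  also have "\<dots> = g * integral {0..T} (\<lambda>s. exp (l * (u - T)) * (exp (- (l * s)) * f s))"
    by simp
  also have "\<dots> \<le> g * integral {0..T} (\<lambda>s. f s * m (u - s))"
  proof (intro mult_left_mono weight_nonneg)
    have bound: "f s * exp (l * (u - s - T)) \<le> f s * m (u - s)" if "s \<in> {0<..T}" for s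
      using that before[of "u - s"] nonneg[of s] \<open>T \<le> u\<close> by (intro mult_left_mono) auto
    have split: "exp (l * (u - s - T)) = exp (l * (u - T)) * exp (- (l * s))" for s
      unfolding exp_add[symmetric] by (simp add: algebra_simps)
    have pt: "exp (l * (u - T)) * (exp (- (l * s)) * f s) \<le> f s * m (u - s)" if "s \<in> {0<..T}" for s
      using bound[OF that] split[of s] by (simp add: mult_ac)
    have "integral {0..T} (\<lambda>s. exp (l * (u - T)) * (exp (- (l * s)) * f s))
       = integral {0<..<T} (\<lambda>s. exp (l * (u - T)) * (exp (- (l * s)) * f s))"
      by (simp only: integral_open_interval_real)
    also have "\<dots> \<le> integral {0<..<T} (\<lambda>s. f s * m (u - s))"
      using assms \<open>T \<le> u\<close> pt
      by (intro integral_le) (auto simp: integrable_on_open_interval_real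
          intro!: integrable_continuous_interval convolution_integrand_cont
            exp_times_continuous)
    also have "\<dots> = integral {0..T} (\<lambda>s. f s * m (u - s))"
      by (simp only: integral_open_interval_real)
    finally show "integral {0..T} (\<lambda>s. exp (l * (u - T)) * (exp (- (l * s)) * f s))
      \<le> integral {0..T} (\<lambda>s. f s * m (u - s))" .
  qed
  also have "\<dots> \<le> g * integral {0..u} (\<lambda>s. f s * m (u - s))"
  proof (intro mult_left_mono weight_nonneg integral_subset_le)
    show "\<forall>s\<in>{0..u}. 0 \<le> f s * m (u - s)"
    proof
      fix s assume "s \<in> {0..u}"
      then show "0 \<le> f s * m (u - s)"
        using nonneg[of s] solution_ge_one[of "u - s"] by auto
    qed
  qed (use assms \<open>T \<le> u\<close> in \<open>auto intro!: integrable_continuous_interval convolution_integrand_cont\<close>)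
  finally have "exp (l * (u - T)) + 1 \<le> m u"
    using renewal[OF \<open>0 \<le> u\<close>] by simp
  then have "exp (l * (u - T)) < m u" by simp
  moreover have "continuous_on UNIV (\<lambda>s. exp (l * (s - T)))" by (intro continuous_intros)
  then have "((\<lambda>s. exp (l * (s - T))) \<longlongrightarrow> exp (l * (u - T))) (at u)"
    by (simp add: continuous_on_def)
  ultimately have "eventually (\<lambda>s. exp (l * (s - T)) < m u) (at u)"
    by (auto intro: order_tendstoD)
  then obtain d where d: "0 < d" "\<And>s. s \<noteq> u \<Longrightarrow> dist s u < d \<Longrightarrow> exp (l * (s - T)) < m u"
    unfolding eventually_at by auto
  obtain s where s: "s \<in> B" "s < u + d"
    using cInf_lessD[of B "u + d"] B(1) d(1) by (auto simp: u_def)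
  have "u \<le> s" using cInf_lower[OF s(1) B(2)] by (simp add: u_def)
  then have "exp (l * (s - T)) < m u"
    using d(2)[of s] s(2) \<open>exp (l * (u - T)) < m u\<close> by (cases "s = u") (auto simp: dist_real_def)
  also have "\<dots> \<le> m s" using solution_mono \<open>0 \<le> u\<close> \<open>u \<le> s\<close> by auto
  finally show False using s(1) by (simp add: B_def)
qed

lemma rate_tendsto:
  assumes "0 \<le> r"
    and below: "\<And>l. 0 < l \<Longrightarrow> l < r \<Longrightarrow> 1 < g * laplace f l"
    and above: "\<And>l. r < l \<Longrightarrow> g * laplace f l < 1"
  shows "((\<lambda>t. 1 / t * ln (m t)) \<longlongrightarrow> r) at_top"
proof (rule order_tendstoI)
  fix a assume "a < r"
  show "eventually (\<lambda>t. a < 1 / t * ln (m t)) at_top"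
  proof (cases "a < 0")
    case True
    show ?thesis using eventually_gt_at_top[of 0]
    proof eventually_elim
      case (elim t)
      have "0 \<le> 1 / t * ln (m t)" using elim solution_ge_one[of t] by auto
      then show ?case using True by linarith
    qed
  next
    case False
    then obtain l where l: "a < l" "l < r" "0 < l" using dense[OF \<open>a < r\<close>] by auto
    have "((\<lambda>T. g * integral {0..T} (\<lambda>s. exp (- (l * s)) * f s)) \<longlongrightarrow> g * laplace f l) at_top"
      by (intro tendsto_intros truncated_tendsto_laplace l)
    then have "eventually (\<lambda>T. 1 < g * integral {0..T} (\<lambda>s. exp (- (l * s)) * f s)) at_top"
      using below[OF l(3,2)] by (rule order_tendstoD)
    then have "eventually (\<lambda>T. 1 < g * integral {0..T} (\<lambda>s. exp (- (l * s)) * f s) \<and> 0 \<le> T) at_top"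
      using eventually_ge_at_top[of 0] by eventually_elim auto
    then obtain T where T: "1 < g * integral {0..T} (\<lambda>s. exp (- (l * s)) * f s)" "0 \<le> T"
      by (metis (mono_tags, lifting) eventually_happens trivial_limit_at_top_linorder)
    have "((\<lambda>t. l * (t - T) / t) \<longlongrightarrow> l) at_top" by real_asymp
    then have "eventually (\<lambda>t. a < l * (t - T) / t) at_top"
      using l(1) by (rule order_tendstoD)
    then show ?thesis using eventually_gt_at_top[of 0]
    proof eventually_elim
      case (elim t)
      have "exp (l * (t - T)) \<le> m t"
        using elim T l by (intro solution_lower_bound) auto
      then have "ln (exp (l * (t - T))) \<le> ln (m t)"
        using elim solution_ge_one[of t] by (subst ln_le_cancel_iff) auto
      then have "l * (t - T) / t \<le> ln (m t) / t"
        using elim by (intro divide_right_mono) auto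
      then show ?case using elim by simp
    qed
  qed
next
  fix a assume "r < a"
  then obtain l where l: "r < l" "l < a" using dense by blast
  then have "0 < l" using assms by simp
  let ?q = "1 - g * laplace f l"
  have q: "0 < ?q" using above[OF l(1)] by simp
  have "((\<lambda>t. (l * t + c) / t) \<longlongrightarrow> l) at_top" for c by real_asymp
  then have "eventually (\<lambda>t. (l * t + ln (1 / ?q)) / t < a) at_top"
    using l(2) by (rule order_tendstoD)
  then show "eventually (\<lambda>t. 1 / t * ln (m t) < a) at_top"
    using eventually_gt_at_top[of 0]
  proof eventually_elim
    case (elim t)
    have "m t \<le> exp (l * t) / ?q"
      using elim \<open>0 < l\<close> q by (intro solution_upper_bound) auto
    then have "ln (m t) \<le> ln (exp (l * t) * (1 / ?q))"
      using elim solution_ge_one[of t] q by (subst ln_le_cancel_iff) auto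
    also have "\<dots> = l * t + ln (1 / ?q)"
      using q by (subst ln_mult) auto
    finally have "ln (m t) / t \<le> (l * t + ln (1 / ?q)) / t"
      using elim by (intro divide_right_mono) auto
    then show ?case using elim by simp
  qed
qed

end

context return_function
begin

lemma laplace_continuous: "continuous_on {0<..} (laplace f)"
proof -
  have "continuous_on {0<..} (\<lambda>l. Re (complex_laplace (of_real l)))"
    by (intro continuous_intros continuous_on_compose2[OF
          holomorphic_on_imp_continuous_on[OF complex_laplace_holomorphic]]) auto
  then show ?thesis by (simp add: complex_laplace_of_real)
qed

text \<open>
  By \<open>total_mass_eq_SUP_laplace\<close>; the total mass is positive, so that its reciprocal behaves as expected
  also in the extended nonnegative reals.
\<close>
lemma threshold_iff:
  assumes "0 \<le> c"
  shows "1 / total_mass < ennreal c \<longleftrightarrow> (\<exists>l>0. 1 < c * laplace f l)"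
proof (cases "c = 0")
  case False
  then have c: "0 < c" using assms by simp
  have "1 / total_mass < ennreal c \<longleftrightarrow> ennreal (1 / c) < total_mass"
  proof (cases total_mass)
    case (real G)
    have "0 < total_mass"
      using laplace_le_total_mass[of 1] laplace_pos[of 1] by (auto intro: less_le_trans[rotated])
    then have "0 < G" using real by simp
    then show ?thesis
      using real c divide_ennreal[of 1 G] by (simp add: ennreal_less_iff field_simps)
  qed (use c in simp)
  also have "\<dots> \<longleftrightarrow> (\<exists>l>0. 1 < c * laplace f l)"
  proof
    assume "ennreal (1 / c) < total_mass"
    then obtain n where "ennreal (1 / c) < ennreal (laplace f (1 / real (Suc n)))"
      unfolding total_mass_eq_SUP_laplace less_SUP_iff by blast
    then have "1 < c * laplace f (1 / real (Suc n))"
      using c by (simp add: ennreal_less_iff field_simps)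
    then show "\<exists>l>0. 1 < c * laplace f l" by (intro exI[of _ "1 / real (Suc n)"]) auto
  next
    assume "\<exists>l>0. 1 < c * laplace f l"
    then obtain l where l: "0 < l" "1 < c * laplace f l" by auto
    then have "ennreal (1 / c) < ennreal (laplace f l)"
      using c by (simp add: ennreal_less_iff field_simps)
    also have "\<dots> \<le> total_mass" by (rule laplace_le_total_mass[OF l(1)])
    finally show "ennreal (1 / c) < total_mass" .
  qed
  finally show ?thesis .
qed simp

text \<open>
  The exponent is the solution of \<open>c * laplace f r = 1\<close> if there is one; it exists exactly above the
  threshold, by the intermediate value theorem. Below the threshold, and at it, the product is less than \<open>1\<close> on
  the whole half-line, and \<open>0\<close> takes the role of \<open>r\<close>.
\<close>
lemma critical_exponent:
  assumes "0 \<le> c"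
  obtains r where "0 \<le> r" "0 < r \<longleftrightarrow> 1 / total_mass < ennreal c" "0 < r \<Longrightarrow> c * laplace f r = 1"
    "\<And>l. 0 < l \<Longrightarrow> l < r \<Longrightarrow> 1 < c * laplace f l" "\<And>l. r < l \<Longrightarrow> c * laplace f l < 1"
proof (cases "\<exists>l>0. 1 < c * laplace f l")
  case True
  then obtain l where l: "0 < l" "1 < c * laplace f l" by auto
  then have "0 < c" using assms by (cases "c = 0") auto
  obtain k where k: "l \<le> k" "c \<le> k" using max.cobounded1 max.cobounded2 by blast
  have "c * laplace f k \<le> c * (1 / k)"
    using l k by (intro mult_left_mono laplace_le_inverse assms) auto
  also have "\<dots> \<le> 1" using l k by (simp add: field_simps)
  finally have "c * laplace f k \<le> 1" .
  moreover have "continuous_on {l..k} (\<lambda>l. c * laplace f l)"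
    using l by (intro continuous_intros continuous_on_subset[OF laplace_continuous]) auto
  ultimately have "\<exists>r\<ge>l. r \<le> k \<and> c * laplace f r = 1"
    using IVT2'[of "\<lambda>l. c * laplace f l" k 1 l] l(2) k(1) less_imp_le by blast
  then obtain r where r: "l \<le> r" "c * laplace f r = 1" by blast
  show ?thesis
  proof (rule that[of r])
    show "0 < r \<longleftrightarrow> 1 / total_mass < ennreal c"
      using True threshold_iff[OF assms] l r by simp
    show "1 < c * laplace f l" if "0 < l" "l < r" for l
      using mult_strict_left_mono[OF laplace_strict_antimono[OF that] \<open>0 < c\<close>] r by simp
    show "c * laplace f l < 1" if "r < l" for l
      using mult_strict_left_mono[OF laplace_strict_antimono[OF _ that] \<open>0 < c\<close>] r l by simp
  qed (use l r in auto)
next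
  case False
  show ?thesis
  proof (rule that[of 0])
    show "0 < (0::real) \<longleftrightarrow> 1 / total_mass < ennreal c"
      using False threshold_iff[OF assms] by simp
    show "c * laplace f l < 1" if "0 < l" for l
    proof (cases "c = 0")
      case False
      then have "c * laplace f l < c * laplace f (l / 2)"
        using that assms by (intro mult_strict_left_mono laplace_strict_antimono) auto
      also have "\<dots> \<le> 1" using \<open>\<not> (\<exists>l>0. 1 < c * laplace f l)\<close> half_gt_zero[OF that] by (meson not_less)
      finally show ?thesis .
    qed simp
  qed auto
qed

end

section \<open>Convexity lemmas\<close>

lemma strictly_convex_onI:
  fixes f :: "real \<Rightarrow> real"
  assumes "convex A"
    and "\<And>x y u. x \<in> A \<Longrightarrow> y \<in> A \<Longrightarrow> x < y \<Longrightarrow> 0 < u \<Longrightarrow> u < 1 \<Longrightarrow>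
      f ((1 - u) * x + u * y) < (1 - u) * f x + u * f y"
  shows "strictly_convex_on A f"
  unfolding strictly_convex_on_def
proof (intro conjI ballI allI impI)
  fix x y u :: real assume *: "x \<in> A" "y \<in> A" "x \<noteq> y" "0 < u" "u < 1"
  show "f ((1 - u) * x + u * y) < (1 - u) * f x + u * f y"
  proof (cases "x < y")
    case True
    with * show ?thesis by (intro assms(2)) auto
  next
    case False
    with * assms(2)[of y x "1 - u"] show ?thesis by (simp add: add.commute)
  qed
qed (rule assms(1))

text \<open>
  The difference \<open>g\<close> of the function and its chord is nonpositive and convex. Where \<open>g\<close>
  vanishes, at \<open>w\<close>, it cannot be negative at \<open>w + d\<close>, since \<open>0 \<le> 2 * g w \<le> g (w - d) + g (w + d)\<close>.
\<close>
lemma convex_touching_chord_affine: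
  fixes f :: "real \<Rightarrow> real"
  assumes conv: "convex_on {x..y} f" and "x < y" "0 < u" "u < 1"
    and touch: "(1 - u) * f x + u * f y \<le> f ((1 - u) * x + u * y)"
  obtains z h where "x < z" "0 < h" "z + h < y"
    "\<And>c. c \<in> {z..z + h} \<Longrightarrow> f c = f x + (f y - f x) / (y - x) * (c - x)"
proof -
  define k where "k = (f y - f x) / (y - x)"
  define g where "g c = f c - (f x + k * (c - x))" for c
  define w where "w = (1 - u) * x + u * y"
  define e where "e = min (w - x) (y - w) / 2"
  have w: "w - x = u * (y - x)" "y - w = (1 - u) * (y - x)" by (auto simp: w_def algebra_simps)
  have "0 < w - x" "0 < y - w" unfolding w using assms by auto
  then have wb: "x < w" "w < y" by auto
  then have e: "0 < e" "w + e < y" "x < w - e" by (auto simp: e_def min_def field_simps)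
  have below: "g c \<le> 0" if "c \<in> {x..y}" for c
  proof -
    have "f c \<le> (f y - f x) / (y - x) * (c - x) + f x"
      using convex_onD_Icc'[OF conv that] by simp
    then show ?thesis by (simp add: g_def k_def)
  qed
  have "k * (w - x) = u * (f y - f x)" using \<open>x < y\<close> unfolding k_def w(1) by simp
  moreover have "(1 - u) * f x + u * f y = f x + u * (f y - f x)" by (simp add: algebra_simps)
  ultimately have gw: "0 \<le> g w" using touch unfolding g_def w_def[symmetric] by linarith
  have zero: "g (w + d) = 0" if d: "0 \<le> d" "d \<le> e" for d
  proof -
    have "f ((1 - 1/2) *\<^sub>R (w - d) + (1/2) *\<^sub>R (w + d)) \<le> (1 - 1/2) * f (w - d) + 1/2 * f (w + d)"
      using d e wb by (intro convex_onD[OF conv]) auto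
    then have "2 * f w \<le> f (w - d) + f (w + d)" by (simp add: field_simps)
    then have "2 * g w \<le> g (w - d) + g (w + d)" by (simp add: g_def algebra_simps)
    moreover have "g (w - d) \<le> 0" "g (w + d) \<le> 0" using d e wb by (auto intro!: below)
    ultimately show ?thesis using gw by linarith
  qed
  have "f c = f x + k * (c - x)" if "c \<in> {w..w + e}" for c
    using zero[of "c - w"] that by (simp add: g_def)
  then show ?thesis
    using that[of w e] wb e by (simp add: k_def)
qed

section \<open>Exponentials of integrals\<close>

lemma quadratic_increments_imp_constant:
  fixes D :: "real \<Rightarrow> real"
  assumes bound: "\<And>a b. 0 \<le> a \<Longrightarrow> a \<le> b \<Longrightarrow> b \<le> t \<Longrightarrow> \<bar>D b - D a\<bar> \<le> K * (b - a)\<^sup>2"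
    and "0 \<le> t"
  shows "D 0 = D t"
proof -
  have "(D has_field_derivative 0) (at x within {0..t})" if x: "x \<in> {0..t}" for x
    unfolding has_field_derivative_iff
  proof (rule Lim_null_comparison)
    show "\<forall>\<^sub>F y in at x within {0..t}. norm ((D y - D x) / (y - x)) \<le> K * \<bar>y - x\<bar>"
      unfolding eventually_at_filter
    proof (intro always_eventually allI impI)
      fix y assume y: "y \<noteq> x" "y \<in> {0..t}"
      have "\<bar>D y - D x\<bar> \<le> K * (y - x)\<^sup>2"
        using bound[of x y] bound[of y x] x y by (cases "x \<le> y") (auto simp: abs_minus_commute power2_commute)
      then have "\<bar>D y - D x\<bar> \<le> K * \<bar>y - x\<bar> * \<bar>y - x\<bar>" by (simp add: power2_eq_square mult.assoc)
      then show "norm ((D y - D x) / (y - x)) \<le> K * \<bar>y - x\<bar>"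
        using y by (simp add: abs_divide pos_divide_le_eq)
    qed
    have "((\<lambda>y. K * \<bar>y - x\<bar>) \<longlongrightarrow> K * \<bar>x - x\<bar>) (at x within {0..t})"
      by (intro tendsto_intros)
    then show "((\<lambda>y. K * \<bar>y - x\<bar>) \<longlongrightarrow> 0) (at x within {0..t})" by simp
  qed
  then obtain c where "\<And>x. x \<in> {0..t} \<Longrightarrow> D x = c"
    using has_field_derivative_zero_constant[of "{0..t}" D] by (auto simp: convex_real_interval)
  then show ?thesis using \<open>0 \<le> t\<close> by auto
qed

text \<open>
  Instances are the indicators of the visits to \<open>i\<close> along a path. They are merely measurable, so the
  fundamental theorem of calculus is not directly applicable to their integrals.
\<close>
locale unit_density =
  fixes w :: "real \<Rightarrow> real"
  assumes density_measurable: "w \<in> borel_measurable borel"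
    and density_nonneg: "\<And>s. 0 \<le> w s"
    and density_le_one: "\<And>s. w s \<le> 1"
begin

lemma density_integrable: "set_integrable lborel {a..b} w"
proof (rule set_integrable_bound)
  show "set_integrable lborel {a..b} (\<lambda>_. 1 :: real)"
    by (intro borel_integrable_atLeastAtMost' continuous_intros)
  show "set_borel_measurable lborel {a..b} w"
    using density_measurable unfolding set_borel_measurable_def by measurable
qed (use density_nonneg density_le_one in \<open>auto intro!: AE_I2\<close>)

lemmas density_integrable_on = set_borel_integral_eq_integral(1)[OF density_integrable]
lemmas density_integral_eq = set_borel_integral_eq_integral(2)[OF density_integrable]

lemma density_integral_nonneg: "0 \<le> (LBINT u:{a..b}. w u)"
  unfolding density_integral_eq
  by (intro Henstock_Kurzweil_Integration.integral_nonneg density_integrable_on density_nonneg)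

lemma density_integral_le:
  assumes "a \<le> b"
  shows "(LBINT u:{a..b}. w u) \<le> b - a"
proof -
  have "integral {a..b} w \<le> integral {a..b} (\<lambda>_. 1)"
    by (intro integral_le density_integrable_on density_le_one) auto
  then show ?thesis using assms by (simp add: density_integral_eq)
qed

lemma density_integral_split:
  assumes "a \<le> b" "b \<le> c"
  shows "(LBINT u:{a..c}. w u) = (LBINT u:{a..b}. w u) + (LBINT u:{b..c}. w u)"
  unfolding density_integral_eq
  using assms by (intro Henstock_Kurzweil_Integration.integral_combine[symmetric] density_integrable_on)

text \<open>
  Formally this integrates the derivative of \<open>exp (c * I s)\<close>, which need not exist everywhere. Instead,
  the sum \<open>D a\<close> of \<open>exp (c * I a)\<close> and \<open>c\<close> times the integral over \<open>{0..a}\<close> has quadratically small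
  increments, because \<open>exp x - 1\<close> and \<open>x\<close> agree to first order. Hence \<open>D\<close> is constant, and the two sides
  are its values at \<open>0\<close> and \<open>t\<close>.
\<close>
lemma exp_integral_identity:
  assumes "0 \<le> c" "0 \<le> t"
  defines "I \<equiv> \<lambda>s. LBINT u:{s..t}. w u"
  shows "set_integrable lborel {0..t} (\<lambda>s. w s * exp (c * I s))"
    and "exp (c * I 0) = 1 + c * (LBINT s:{0..t}. w s * exp (c * I s))"
proof -
  note w = density_nonneg density_le_one and meas = density_measurable and hk = density_integrable_on
  have I: "I s = integral {s..t} w" for s
    by (simp add: I_def density_integral_eq)
  note len = density_integral_nonneg[unfolded density_integral_eq]
    density_integral_le[unfolded density_integral_eq]
  have split: "I a = integral {a..b} w + I b" if "a \<le> b" "b \<le> t" for a b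
    using density_integral_split[OF that] by (simp add: I_def density_integral_eq)
  have contI: "continuous_on {0..t} I"
    unfolding I by (rule indefinite_integral_continuous_1'[OF hk])
  have bnd: "exp (c * I s) \<le> exp (c * t)" if "s \<in> {0..t}" for s
    using that len(2)[of s t] \<open>0 \<le> c\<close> by (auto simp: I intro!: mult_left_mono)
  let ?k = "\<lambda>s. w s * exp (c * I s)"
  show int_k: "set_integrable lborel {0..t} ?k"
  proof (rule set_integrable_bound)
    show "set_integrable lborel {0..t} (\<lambda>_. exp (c * t))"
      by (intro borel_integrable_atLeastAtMost' continuous_intros)
    have "(\<lambda>s. indicator {0..t} s *\<^sub>R exp (c * I s)) \<in> borel_measurable borel"
      by (intro borel_measurable_continuous_on_indicator continuous_intros contI) auto
    then have "(\<lambda>s. w s * (indicator {0..t} s *\<^sub>R exp (c * I s))) \<in> borel_measurable borel"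
      using meas by measurable
    then show "set_borel_measurable lborel {0..t} ?k"
      unfolding set_borel_measurable_def by (simp add: mult_ac)
    show "AE s in lborel. s \<in> {0..t} \<longrightarrow> norm (?k s) \<le> norm (exp (c * t))"
    proof (intro AE_I2 impI)
      fix s assume "s \<in> {0..t}"
      then have "w s * exp (c * I s) \<le> 1 * exp (c * t)"
        using w by (intro mult_mono bnd) auto
      then show "norm (?k s) \<le> norm (exp (c * t))" using w by (simp add: abs_mult)
    qed
  qed
  have hk_k: "?k integrable_on {a..b}" if "0 \<le> a" "b \<le> t" for a b
    using that integrable_subinterval_real[OF set_borel_integral_eq_integral(1)[OF int_k], of a b] by auto
  define D where "D a = exp (c * I a) + c * integral {0..a} ?k" for a
  have "\<bar>D b - D a\<bar> \<le> (c\<^sup>2 * exp (c * t)) * (b - a)\<^sup>2" if ab: "0 \<le> a" "a \<le> b" "b \<le> t" for a b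
  proof -
    define v where "v = integral {a..b} w"
    define E where "E = exp (c * I b)"
    have v: "0 \<le> v" "v \<le> b - a" using len[of a b] ab by (auto simp: v_def)
    have Ia: "exp (c * I a) = E * exp (c * v)"
      using split[of a b] ab by (simp add: v_def E_def exp_add[symmetric] algebra_simps)
    have "integral {0..b} ?k = integral {0..a} ?k + integral {a..b} ?k"
      using ab hk_k[of 0 b]
      by (intro Henstock_Kurzweil_Integration.integral_combine[symmetric]) auto
    then have diff: "D b - D a = c * integral {a..b} ?k - E * (exp (c * v) - 1)"
      using Ia by (simp add: D_def E_def algebra_simps)
    have mid: "E \<le> exp (c * I s)" "exp (c * I s) \<le> E * exp (c * v)" if "s \<in> {a..b}" for s
    proof -
      have "I b \<le> I s" "I s \<le> I a"
        using split[of s b] split[of a s] len(1) that ab by auto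
      then have "E \<le> exp (c * I s)" "exp (c * I s) \<le> exp (c * I a)"
        using \<open>0 \<le> c\<close> by (auto simp: E_def intro: mult_left_mono)
      then show "E \<le> exp (c * I s)" "exp (c * I s) \<le> E * exp (c * v)"
        by (simp_all only: Ia)
    qed
    have "integral {a..b} (\<lambda>s. w s * E) \<le> integral {a..b} ?k"
      using ab w mid by (intro integral_le integrable_on_mult_left hk hk_k mult_left_mono) auto
    then have "c * (v * E) \<le> c * integral {a..b} ?k"
      using \<open>0 \<le> c\<close> by (intro mult_left_mono) (auto simp: v_def)
    then have lo1: "E * (c * v) \<le> c * integral {a..b} ?k" by (simp add: mult_ac)
    have "integral {a..b} ?k \<le> integral {a..b} (\<lambda>s. w s * (E * exp (c * v)))"
      using ab w mid by (intro integral_le integrable_on_mult_left hk hk_k mult_left_mono) auto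
    then have "c * integral {a..b} ?k \<le> c * (v * (E * exp (c * v)))"
      using \<open>0 \<le> c\<close> by (intro mult_left_mono) (auto simp: v_def)
    then have hi1: "c * integral {a..b} ?k \<le> E * (c * v * exp (c * v))" by (simp add: mult_ac)
    have "c * v \<le> exp (c * v) - 1" using exp_ge_add_one_self[of "c * v"] by linarith
    then have lo2: "E * (c * v) \<le> E * (exp (c * v) - 1)"
      by (intro mult_left_mono) (simp_all add: E_def)
    have e: "exp x - 1 \<le> x * exp x" for x :: real
    proof -
      have "(1 - x) * exp x \<le> exp (- x) * exp x"
        using exp_ge_add_one_self[of "- x"] by (intro mult_right_mono) auto
      then show ?thesis by (simp add: exp_minus_inverse algebra_simps)
    qed
    have hi2: "E * (exp (c * v) - 1) \<le> E * (c * v * exp (c * v))"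
      using e[of "c * v"] by (intro mult_left_mono) (auto simp: E_def)
    have "\<bar>D b - D a\<bar> \<le> E * (c * v * exp (c * v)) - E * (c * v)"
      using lo1 lo2 hi1 hi2 diff by linarith
    also have "\<dots> = E * (c * v) * (exp (c * v) - 1)" by (simp add: algebra_simps)
    also have "\<dots> \<le> E * (c * v) * (c * v * exp (c * v))"
      using e[of "c * v"] v \<open>0 \<le> c\<close> by (intro mult_left_mono) (auto simp: E_def)
    also have "\<dots> = (E * exp (c * v)) * (c\<^sup>2 * v\<^sup>2)" by (simp add: power2_eq_square mult_ac)
    also have "\<dots> \<le> exp (c * t) * (c\<^sup>2 * (b - a)\<^sup>2)"
    proof (rule mult_mono)
      show "c\<^sup>2 * v\<^sup>2 \<le> c\<^sup>2 * (b - a)\<^sup>2"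
        using v by (intro mult_left_mono power_mono) auto
    qed (use bnd[of a] ab in \<open>auto simp: Ia\<close>)
    finally show ?thesis by (simp add: mult_ac)
  qed
  then have "D 0 = D t"
    using \<open>0 \<le> t\<close> by (rule quadratic_increments_imp_constant)
  then show "exp (c * I 0) = 1 + c * (LBINT s:{0..t}. ?k s)"
    using set_borel_integral_eq_integral(2)[OF int_k] by (simp add: D_def I)
qed

end

lemma ennreal_exp_eq_suminf:
  assumes "0 \<le> c" "0 \<le> x"
  shows "ennreal (exp (c * x)) = (\<Sum>n. ennreal (c ^ n / fact n) * ennreal x ^ n)"
proof -
  have s: "(\<lambda>n. (c * x) ^ n /\<^sub>R fact n) sums exp (c * x)" by (rule exp_converges)
  have "ennreal (exp (c * x)) = (\<Sum>n. ennreal ((c * x) ^ n /\<^sub>R fact n))"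
    using s assms by (subst suminf_ennreal2) (auto simp: sums_iff)
  also have "\<dots> = (\<Sum>n. ennreal (c ^ n / fact n) * ennreal x ^ n)"
    using assms by (intro suminf_cong)
      (simp add: ennreal_mult[symmetric] ennreal_power power_mult_distrib field_simps)
  finally show ?thesis .
qed

section \<open>Visits to the initial state\<close>

locale process_from_state = homogeneous_markov_process M S X p
  for M :: "'w measure" and S :: "'s set" and X :: "real \<Rightarrow> 'w \<Rightarrow> 's"
    and p :: "real \<Rightarrow> 's \<Rightarrow> 's \<Rightarrow> real" +
  fixes i :: 's
  assumes state: "i \<in> S"
    and start: "AE \<omega> in M. X 0 \<omega> = i"
    and return_cont: "continuous_on {0..} (\<lambda>t. p t i i)"
begin

abbreviation ret :: "real \<Rightarrow> real" where
  "ret t \<equiv> p t i i"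

lemma transition_nonneg: "0 \<le> t \<Longrightarrow> x \<in> S \<Longrightarrow> y \<in> S \<Longrightarrow> 0 \<le> p t x y"
  using transition by (auto simp: transition_function_def)

text \<open>
  The Chapman-Kolmogorov equation restricted to finitely many intermediate states.
\<close>
lemma ret_plus_lower_bound:
  assumes "0 \<le> s" "0 \<le> t" "F \<subseteq> S" "finite F"
  shows "(\<Sum>y\<in>F. p s i y * p t y i) \<le> ret (s + t)"
proof (rule finite_sum_le_has_sum)
  show "((\<lambda>y. p s i y * p t y i) has_sum ret (s + t)) S"
    using transition state assms by (auto simp: transition_function_def)
qed (use assms state transition_nonneg in auto)

lemma ret_supermultiplicative: "0 \<le> s \<Longrightarrow> 0 \<le> t \<Longrightarrow> ret s * ret t \<le> ret (s + t)"
  using ret_plus_lower_bound[of s t "{i}"] state by simp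

sublocale return_function ret
proof
  show "continuous_on {0..} ret" by (rule return_cont)
  show "0 \<le> ret t" if "0 \<le> t" for t using transition_nonneg state that by auto
  show "ret t \<le> 1" if "0 \<le> t" for t
  proof -
    have "(p t i has_sum 1) S" using transition state that by (auto simp: transition_function_def)
    then have "sum (p t i) {i} \<le> 1"
      using state transition_nonneg that by (intro finite_sum_le_has_sum) auto
    then show ?thesis by simp
  qed
  show "ret 0 = 1" using transition state by (auto simp: transition_function_def)
qed

text \<open>
  Truncating the time at \<open>0\<close> turns the process into a jointly measurable function on the whole line, so that
  Fubini can be applied with respect to Lebesgue measure.
\<close>
definition visit :: "real \<Rightarrow> 'w \<Rightarrow> real" where
  "visit s \<omega> = indicator {0..} s * indicator {i} (X (max 0 s) \<omega>)"

lemma visit_eq: "0 \<le> s \<Longrightarrow> visit s \<omega> = indicator {i} (X s \<omega>)"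
  by (simp add: visit_def)

lemma visit_range: "0 \<le> visit s \<omega>" "visit s \<omega> \<le> 1"
  by (auto simp: visit_def indicator_def)

lemma visit_measurable_pair: "(\<lambda>x. visit (fst x) (snd x)) \<in> borel_measurable (borel \<Otimes>\<^sub>M M)"
proof -
  have "(\<lambda>x. (max (0::real) (fst x), snd x)) \<in> borel \<Otimes>\<^sub>M M \<rightarrow>\<^sub>M restrict_space borel {0..} \<Otimes>\<^sub>M M"
    by (intro measurable_Pair measurable_restrict_space2) auto
  from measurable_compose[OF this measurable_process]
  have "(\<lambda>x. X (max 0 (fst x)) (snd x)) \<in> borel \<Otimes>\<^sub>M M \<rightarrow>\<^sub>M count_space S"
    by simp
  then have "(\<lambda>x. indicator {i} (X (max 0 (fst x)) (snd x)) :: real) \<in> borel_measurable (borel \<Otimes>\<^sub>M M)"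
    by (rule measurable_compose) simp
  then show ?thesis unfolding visit_def by measurable
qed

lemma visit_measurable [measurable (raw)]:
  assumes "f \<in> N \<rightarrow>\<^sub>M borel" "h \<in> N \<rightarrow>\<^sub>M M"
  shows "(\<lambda>x. visit (f x) (h x)) \<in> borel_measurable N"
  using measurable_compose[OF measurable_Pair[OF assms] visit_measurable_pair] by simp

definition hit :: "real set \<Rightarrow> 'w set" where
  "hit U = {\<omega> \<in> space M. \<forall>u\<in>U. X u \<omega> = i}"

lemma hit_eq_visit:
  assumes "U \<subseteq> {0..}"
  shows "hit U = {\<omega> \<in> space M. \<forall>u\<in>U. visit u \<omega> = 1}"
  using assms by (auto simp: hit_def visit_eq subset_iff indicator_def split: if_splits)

lemma hit_measurable [measurable]:
  assumes "finite U" "U \<subseteq> {0..}"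
  shows "hit U \<in> sets M"
proof -
  have "{\<omega> \<in> space M. \<forall>u\<in>U. visit u \<omega> = 1} \<in> sets M"
    using assms(1) by measurable
  then show ?thesis by (simp only: hit_eq_visit[OF assms(2)])
qed

lemma hit_insert_zero:
  assumes "finite U" "U \<subseteq> {0..}"
  shows "prob (hit (insert 0 U)) = prob (hit U)"
proof (rule finite_measure_eq_AE)
  show "AE \<omega> in M. \<omega> \<in> hit (insert 0 U) \<longleftrightarrow> \<omega> \<in> hit U"
    using start by eventually_elim (auto simp: hit_def)
  show "hit (insert 0 U) \<in> events" "hit U \<in> events"
    using assms by (auto intro!: hit_measurable)
qed

text \<open>
  The Markov property for the event that the path is at \<open>i\<close> at all times in \<open>U\<close>; it is stated for
  enumerated times, which here come from sorting \<open>U\<close>.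
\<close>
lemma prob_hit_insert:
  assumes U: "finite U" "U \<subseteq> {0..}" and max: "a \<in> U" "\<And>u. u \<in> U \<Longrightarrow> u \<le> a" and "0 \<le> s"
  shows "prob (hit (insert (a + s) U)) = prob (hit U) * ret s"
proof (cases "prob (hit U) = 0")
  case True
  have "prob (hit (insert (a + s) U)) \<le> prob (hit U)"
  proof (rule finite_measure_mono)
    show "hit (insert (a + s) U) \<subseteq> hit U" by (auto simp: hit_def)
  qed (rule hit_measurable[OF U])
  then show ?thesis using True measure_nonneg[of M "hit (insert (a + s) U)"] by simp
next
  case False
  then have pos: "0 < prob (hit U)" by (simp add: zero_less_measure_iff)
  define t where "t k = sorted_list_of_set U ! k" for k
  define n where "n = card U - 1"
  have "card U \<noteq> 0" using U(1) max(1) by auto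
  then have card: "card U = Suc n" by (simp add: n_def)
  have len: "length (sorted_list_of_set U) = Suc n" using card by simp
  have range: "t ` {..n} = U"
  proof -
    have "U = (\<lambda>k. sorted_list_of_set U ! k) ` {..<Suc n}"
      using U(1) set_conv_nth[of "sorted_list_of_set U"] len by (auto simp: image_def)
    then show ?thesis by (auto simp: t_def[abs_def] lessThan_Suc_atMost)
  qed
  have mono: "strict_mono_on {..n} t"
    using sorted_wrt_nth_less[OF strict_sorted_list_of_set[of U]] len
    by (auto simp: strict_mono_on_def t_def)
  have last: "t n = a"
  proof (rule antisym)
    show "t n \<le> a" using range max(2) by auto
    obtain k where "k \<le> n" "a = t k" using range max(1) by auto
    then show "a \<le> t n"
      using strict_mono_onD[OF mono, of k n] by (cases "k = n") auto
  qed
  have "0 \<le> t 0" using range U(2) by auto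
  have ball: "(\<forall>k\<le>n. X (t k) \<omega> = i) \<longleftrightarrow> (\<forall>u\<in>U. X u \<omega> = i)" for \<omega>
    unfolding range[symmetric] by auto
  have "\<P>(\<omega> in M. X (t n + s) \<omega> = i \<bar> \<forall>k\<le>n. X (t k) \<omega> = i) = ret s"
    using markov_property[OF \<open>0 \<le> t 0\<close> mono, of "\<lambda>_. i" s i] pos state \<open>0 \<le> s\<close>
    by (simp add: ball hit_def)
  then have "prob {\<omega> \<in> space M. X (a + s) \<omega> = i \<and> (\<forall>u\<in>U. X u \<omega> = i)} / prob (hit U) = ret s"
    unfolding cond_prob_def by (simp add: ball last hit_def)
  moreover have "hit (insert (a + s) U) = {\<omega> \<in> space M. X (a + s) \<omega> = i \<and> (\<forall>u\<in>U. X u \<omega> = i)}"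
    by (auto simp: hit_def)
  ultimately show ?thesis using pos by (simp add: field_simps)
qed

text \<open>
  The Markov property at time \<open>s\<close> for finitely many later visits. Adding the times in increasing order
  multiplies both sides by the same factor.
\<close>
lemma prob_hit_shift:
  assumes "finite U" "U \<subseteq> {0..}" "0 \<le> s"
  shows "prob (hit ((+) s ` insert 0 U)) = ret s * prob (hit (insert 0 U))"
  using assms(1,2)
proof (induction U rule: finite_linorder_max_induct)
  case empty
  have one: "prob (hit {0}) = 1"
  proof (rule prob_eq_1[THEN iffD2])
    show "hit {0} \<in> events" by (intro hit_measurable) auto
    show "AE \<omega> in M. \<omega> \<in> hit {0}"
      using start AE_space by eventually_elim (auto simp: hit_def)
  qed
  have "prob (hit {s}) = prob (hit (insert (0 + s) {0}))"
    using hit_insert_zero[of "{s}"] \<open>0 \<le> s\<close> by (simp add: insert_commute)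
  also have "\<dots> = prob (hit {0}) * ret s"
    using \<open>0 \<le> s\<close> by (intro prob_hit_insert) auto
  finally show ?case using one by simp
next
  case (insert b U)
  show ?case
  proof (cases "b = 0")
    case True
    then have "U = {}" using insert.hyps(2) insert.prems by force
    then show ?thesis using insert.IH True by simp
  next
    case False
    define a where "a = Max (insert 0 U)"
    have a: "a \<in> insert 0 U" "\<And>u. u \<in> insert 0 U \<Longrightarrow> u \<le> a"
      using insert.hyps(1) Max_in[of "insert 0 U"] by (auto simp: a_def)
    have "a \<le> b" using a(1) insert.hyps(2) insert.prems by auto
    have "prob (hit (insert (a + (b - a)) (insert 0 U))) = prob (hit (insert 0 U)) * ret (b - a)"
      using a insert.hyps insert.prems \<open>a \<le> b\<close> by (intro prob_hit_insert) auto
    moreover have "prob (hit (insert ((s + a) + (b - a)) ((+) s ` insert 0 U)))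
        = prob (hit ((+) s ` insert 0 U)) * ret (b - a)"
      using a insert.hyps insert.prems \<open>a \<le> b\<close> \<open>0 \<le> s\<close> by (intro prob_hit_insert) auto
    ultimately show ?thesis
      using insert.IH insert.prems by (simp add: insert_commute)
  qed
qed

text \<open>
  The occupation time of \<open>i\<close> during \<open>{a..b}\<close> as an extended real, which frees the
  manipulations of its moments from integrability conditions.
\<close>
definition occ :: "real \<Rightarrow> real \<Rightarrow> 'w \<Rightarrow> ennreal" where
  "occ a b \<omega> = (\<integral>\<^sup>+v. ennreal (indicator {a..b} v * visit v \<omega>) \<partial>lborel)"

lemma occ_measurable [measurable (raw)]:
  assumes [measurable]: "a \<in> borel_measurable N" "b \<in> borel_measurable N" "h \<in> N \<rightarrow>\<^sub>M M"
  shows "(\<lambda>x. occ (a x) (b x) (h x)) \<in> borel_measurable N"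
proof -
  have "(\<lambda>y. indicator {a (fst y)..b (fst y)} (snd y) :: real) \<in> borel_measurable (N \<Otimes>\<^sub>M lborel)"
    unfolding indicator_def atLeastAtMost_iff by measurable
  then have "(\<lambda>(x, v). ennreal (indicator {a x..b x} v * visit v (h x))) \<in> borel_measurable (N \<Otimes>\<^sub>M lborel)"
    unfolding case_prod_unfold by measurable
  then show ?thesis unfolding occ_def by measurable
qed

lemma occ_shift:
  "occ s (s + t) \<omega> = (\<integral>\<^sup>+v. ennreal (indicator {0..t} v * visit (s + v) \<omega>) \<partial>lborel)" if "\<omega> \<in> space M"
proof -
  have "(\<lambda>v. ennreal (indicator {s..s+t} v * visit v \<omega>)) \<in> borel_measurable borel"
    using that by measurable
  then have "occ s (s + t) \<omega> = (\<integral>\<^sup>+v. ennreal (indicator {s..s+t} (s + 1 * v) * visit (s + 1 * v) \<omega>) \<partial>lborel)"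
    unfolding occ_def by (subst nn_integral_real_affine[where c=1 and t=s]) auto
  then show ?thesis by (simp add: indicator_def cong: if_cong)
qed

lemma hit_insert_visit:
  assumes "\<omega> \<in> space M" "0 \<le> v"
  shows "(indicator (hit (insert v U)) \<omega> :: ennreal) = ennreal (visit v \<omega>) * indicator (hit U) \<omega>"
  using assms by (auto simp: hit_def visit_eq indicator_def)

text \<open>
  The Markov property at time \<open>s\<close> for moments of the occupation time. Writing one factor of the
  power as an integral over the time \<open>v\<close> of a visit lowers the exponent and adds \<open>v\<close> to the
  set \<open>U\<close> of prescribed visits, so a generalisation over \<open>U\<close> lets the induction reduce everything to
  \<open>prob_hit_shift\<close>.
\<close>
lemma occ_moment_shift:
  assumes "finite U" "U \<subseteq> {0..}" "0 \<le> s"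
  shows "(\<integral>\<^sup>+\<omega>. indicator (hit ((+) s ` insert 0 U)) \<omega> * occ s (s + t) \<omega> ^ n \<partial>M)
    = ennreal (ret s) * (\<integral>\<^sup>+\<omega>. indicator (hit (insert 0 U)) \<omega> * occ 0 t \<omega> ^ n \<partial>M)"
  using assms(1,2)
proof (induction n arbitrary: U)
  case 0
  have "hit ((+) s ` insert 0 U) \<in> events" "hit (insert 0 U) \<in> events"
    using 0 \<open>0 \<le> s\<close> by (auto intro!: hit_measurable)
  then show ?case
    using prob_hit_shift[OF 0 \<open>0 \<le> s\<close>] \<open>0 \<le> s\<close>
    by (simp add: emeasure_eq_measure ennreal_mult nonneg del: image_insert)
next
  case (Suc n)
  interpret pair_sigma_finite lborel M ..
  have peel: "(\<integral>\<^sup>+\<omega>. indicator (hit ((+) r ` insert 0 U)) \<omega> * occ r (r + t) \<omega> ^ Suc n \<partial>M)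
      = (\<integral>\<^sup>+v. indicator {0..t} v *
          (\<integral>\<^sup>+\<omega>. indicator (hit ((+) r ` insert 0 (insert v U))) \<omega> * occ r (r + t) \<omega> ^ n \<partial>M) \<partial>lborel)"
    if "0 \<le> r" for r
  proof -
    have [measurable]: "hit ((+) r ` insert 0 U) \<in> sets M"
      using Suc.prems that by (intro hit_measurable) auto
    let ?k = "\<lambda>v \<omega>. indicator (hit ((+) r ` insert 0 U)) \<omega> * occ r (r + t) \<omega> ^ n *
        ennreal (indicator {0..t} v * visit (r + v) \<omega>)"
    have "(\<integral>\<^sup>+\<omega>. indicator (hit ((+) r ` insert 0 U)) \<omega> * occ r (r + t) \<omega> ^ Suc n \<partial>M)
        = (\<integral>\<^sup>+\<omega>. \<integral>\<^sup>+v. ?k v \<omega> \<partial>lborel \<partial>M)"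
    proof (intro nn_integral_cong)
      fix \<omega> assume [measurable]: "\<omega> \<in> space M"
      have "(\<integral>\<^sup>+v. ?k v \<omega> \<partial>lborel) = indicator (hit ((+) r ` insert 0 U)) \<omega> * occ r (r + t) \<omega> ^ n *
          (\<integral>\<^sup>+v. ennreal (indicator {0..t} v * visit (r + v) \<omega>) \<partial>lborel)"
        by (intro nn_integral_cmult) measurable
      then show "indicator (hit ((+) r ` insert 0 U)) \<omega> * occ r (r + t) \<omega> ^ Suc n
          = (\<integral>\<^sup>+v. ?k v \<omega> \<partial>lborel)"
        using \<open>\<omega> \<in> space M\<close> by (simp add: occ_shift[symmetric] mult_ac)
    qed
    also have "\<dots> = (\<integral>\<^sup>+v. \<integral>\<^sup>+\<omega>. ?k v \<omega> \<partial>M \<partial>lborel)"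
      by (intro Fubini') measurable
    also have "\<dots> = (\<integral>\<^sup>+v. indicator {0..t} v *
          (\<integral>\<^sup>+\<omega>. indicator (hit ((+) r ` insert 0 (insert v U))) \<omega> * occ r (r + t) \<omega> ^ n \<partial>M) \<partial>lborel)"
    proof (intro nn_integral_cong)
      fix v :: real
      show "(\<integral>\<^sup>+\<omega>. ?k v \<omega> \<partial>M) = indicator {0..t} v *
          (\<integral>\<^sup>+\<omega>. indicator (hit ((+) r ` insert 0 (insert v U))) \<omega> * occ r (r + t) \<omega> ^ n \<partial>M)"
      proof (cases "v \<in> {0..t}")
        case True
        have "?k v \<omega> = indicator (hit ((+) r ` insert 0 (insert v U))) \<omega> * occ r (r + t) \<omega> ^ n"
          if "\<omega> \<in> space M" for \<omega>
        proof -
          have "(+) r ` insert 0 (insert v U) = insert (r + v) ((+) r ` insert 0 U)" by auto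
          then show ?thesis
            using True \<open>0 \<le> r\<close> hit_insert_visit[OF that, of "r + v" "(+) r ` insert 0 U"]
            by (simp add: mult_ac)
        qed
        then show ?thesis using True by (auto intro!: nn_integral_cong)
      qed simp
    qed
    finally show ?thesis .
  qed
  have IH: "(\<integral>\<^sup>+\<omega>. indicator (hit ((+) s ` insert 0 (insert v U))) \<omega> * occ s (s + t) \<omega> ^ n \<partial>M)
    = ennreal (ret s) * (\<integral>\<^sup>+\<omega>. indicator (hit (insert 0 (insert v U))) \<omega> * occ 0 t \<omega> ^ n \<partial>M)"
    if "0 \<le> v" for v
    using Suc.prems that by (intro Suc.IH) auto
  let ?I = "\<lambda>v. \<integral>\<^sup>+\<omega>. indicator (hit (insert 0 (insert v U))) \<omega> * occ 0 t \<omega> ^ n \<partial>M"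
  have "(\<integral>\<^sup>+\<omega>. indicator (hit ((+) s ` insert 0 U)) \<omega> * occ s (s + t) \<omega> ^ Suc n \<partial>M)
      = (\<integral>\<^sup>+v. ennreal (ret s) * (indicator {0..t} v * ?I v) \<partial>lborel)"
    unfolding peel[OF \<open>0 \<le> s\<close>]
  proof (intro nn_integral_cong)
    fix v :: real
    show "indicator {0..t} v *
        (\<integral>\<^sup>+\<omega>. indicator (hit ((+) s ` insert 0 (insert v U))) \<omega> * occ s (s + t) \<omega> ^ n \<partial>M)
      = ennreal (ret s) * (indicator {0..t} v * ?I v)"
      by (cases "v \<in> {0..t}") (simp_all add: IH del: image_insert)
  qed
  also have "\<dots> = ennreal (ret s) * (\<integral>\<^sup>+v. indicator {0..t} v * ?I v \<partial>lborel)"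
  proof (rule nn_integral_cmult)
    have [measurable]: "hit (insert 0 U) \<in> sets M"
      using Suc.prems by (intro hit_measurable) auto
    have "(\<lambda>v. indicator {0..t} v * (\<integral>\<^sup>+\<omega>. ennreal (visit v \<omega>) * indicator (hit (insert 0 U)) \<omega> * occ 0 t \<omega> ^ n \<partial>M))
      \<in> borel_measurable lborel" by measurable
    also have "(\<lambda>v. indicator {0..t} v * (\<integral>\<^sup>+\<omega>. ennreal (visit v \<omega>) * indicator (hit (insert 0 U)) \<omega> * occ 0 t \<omega> ^ n \<partial>M))
       = (\<lambda>v. indicator {0..t} v * ?I v)"
    proof
      fix v :: real
      show "indicator {0..t} v * (\<integral>\<^sup>+\<omega>. ennreal (visit v \<omega>) * indicator (hit (insert 0 U)) \<omega> * occ 0 t \<omega> ^ n \<partial>M)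
        = indicator {0..t} v * ?I v"
      proof (cases "v \<in> {0..t}")
        case True
        then have "(\<integral>\<^sup>+\<omega>. ennreal (visit v \<omega>) * indicator (hit (insert 0 U)) \<omega> * occ 0 t \<omega> ^ n \<partial>M) = ?I v"
          by (intro nn_integral_cong) (simp add: hit_insert_visit[symmetric] insert_commute[of 0])
        then show ?thesis by simp
      qed simp
    qed
    finally show "(\<lambda>v. indicator {0..t} v * ?I v) \<in> borel_measurable lborel" .
  qed
  also have "(\<integral>\<^sup>+v. indicator {0..t} v * ?I v \<partial>lborel)
      = (\<integral>\<^sup>+\<omega>. indicator (hit (insert 0 U)) \<omega> * occ 0 t \<omega> ^ Suc n \<partial>M)"
    using peel[of 0] by simp
  finally show ?case .
qed

end

section \<open>The renewal equation for the exponential moments\<close>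

context process_from_state
begin

definition time :: "real \<Rightarrow> real \<Rightarrow> 'w \<Rightarrow> real" where
  "time a b \<omega> = (LBINT v:{a..b}. visit v \<omega>)"

lemma unit_density_visit: "\<omega> \<in> space M \<Longrightarrow> unit_density (\<lambda>s. visit s \<omega>)"
  by unfold_locales (auto simp: visit_range)

lemma occupation_time_eq: "occupation_time X i t \<omega> = time 0 t \<omega>"
  unfolding occupation_time_def time_def
  by (intro set_lebesgue_integral_cong) (auto simp: visit_eq)

lemma time_nonneg: "0 \<le> time a b \<omega>"
  unfolding time_def set_lebesgue_integral_def
  by (intro integral_nonneg_AE AE_I2) (auto simp: visit_range)

lemma occ_eq_time: "\<omega> \<in> space M \<Longrightarrow> occ a b \<omega> = ennreal (time a b \<omega>)"
  unfolding occ_def time_def set_lebesgue_integral_def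
  using unit_density.density_integrable[OF unit_density_visit, of \<omega> a b]
  by (subst nn_integral_eq_integral) (auto simp: set_integrable_def visit_range)

lemma time_measurable [measurable (raw)]:
  assumes [measurable]: "a \<in> borel_measurable N" "b \<in> borel_measurable N" "h \<in> N \<rightarrow>\<^sub>M M"
  shows "(\<lambda>x. time (a x) (b x) (h x)) \<in> borel_measurable N"
proof -
  have "(\<lambda>x. enn2real (occ (a x) (b x) (h x))) \<in> borel_measurable N" by measurable
  moreover have "enn2real (occ (a x) (b x) (h x)) = time (a x) (b x) (h x)" if "x \<in> space N" for x
    using measurable_space[OF assms(3) that] by (simp add: occ_eq_time time_nonneg)
  ultimately show ?thesis by (simp cong: measurable_cong)
qed

lemma time_le: "\<omega> \<in> space M \<Longrightarrow> a \<le> b \<Longrightarrow> time a b \<omega> \<le> b - a"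
  unfolding time_def by (rule unit_density.density_integral_le[OF unit_density_visit])

lemma time_split:
  "\<omega> \<in> space M \<Longrightarrow> a \<le> b \<Longrightarrow> b \<le> c \<Longrightarrow> time a c \<omega> = time a b \<omega> + time b c \<omega>"
  unfolding time_def by (rule unit_density.density_integral_split[OF unit_density_visit])

lemma nn_exp_time_series:
  assumes "0 \<le> r" "0 \<le> c"
  shows "(\<integral>\<^sup>+\<omega>. indicator (hit {r}) \<omega> * ennreal (exp (c * time r (r + t) \<omega>)) \<partial>M)
    = (\<Sum>n. ennreal (c ^ n / fact n) * (\<integral>\<^sup>+\<omega>. indicator (hit {r}) \<omega> * occ r (r + t) \<omega> ^ n \<partial>M))"
proof -
  have [measurable]: "hit {r} \<in> sets M" using assms by (intro hit_measurable) auto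
  have "(\<integral>\<^sup>+\<omega>. indicator (hit {r}) \<omega> * ennreal (exp (c * time r (r + t) \<omega>)) \<partial>M)
      = (\<integral>\<^sup>+\<omega>. (\<Sum>n. ennreal (c ^ n / fact n) * (indicator (hit {r}) \<omega> * occ r (r + t) \<omega> ^ n)) \<partial>M)"
    using assms
    by (intro nn_integral_cong)
      (simp add: ennreal_exp_eq_suminf time_nonneg occ_eq_time ennreal_suminf_cmult[symmetric] mult.left_commute
        del: ennreal_suminf_cmult)
  also have "\<dots> = (\<Sum>n. \<integral>\<^sup>+\<omega>. ennreal (c ^ n / fact n) * (indicator (hit {r}) \<omega> * occ r (r + t) \<omega> ^ n) \<partial>M)"
    by (intro nn_integral_suminf) measurable
  also have "\<dots> = (\<Sum>n. ennreal (c ^ n / fact n) * (\<integral>\<^sup>+\<omega>. indicator (hit {r}) \<omega> * occ r (r + t) \<omega> ^ n \<partial>M))"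
    by (intro suminf_cong nn_integral_cmult) measurable
  finally show ?thesis .
qed

text \<open>
  The Markov property at time \<open>s\<close> for exponentials of the occupation time, by expanding them in moments.
\<close>
lemma nn_exp_time_shift:
  assumes "0 \<le> s" "0 \<le> c"
  shows "(\<integral>\<^sup>+\<omega>. indicator (hit {s}) \<omega> * ennreal (exp (c * time s (s + t) \<omega>)) \<partial>M)
    = ennreal (ret s) * (\<integral>\<^sup>+\<omega>. ennreal (exp (c * time 0 t \<omega>)) \<partial>M)"
proof -
  have "(\<integral>\<^sup>+\<omega>. indicator (hit {s}) \<omega> * ennreal (exp (c * time s (s + t) \<omega>)) \<partial>M)
      = (\<Sum>n. ennreal (ret s) * (ennreal (c ^ n / fact n) * (\<integral>\<^sup>+\<omega>. indicator (hit {0}) \<omega> * occ 0 (0 + t) \<omega> ^ n \<partial>M)))"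
    unfolding nn_exp_time_series[OF assms]
    using occ_moment_shift[of "{}" s t] assms by (simp add: mult_ac)
  also have "\<dots> = ennreal (ret s) * (\<integral>\<^sup>+\<omega>. indicator (hit {0}) \<omega> * ennreal (exp (c * time 0 (0 + t) \<omega>)) \<partial>M)"
    using assms by (simp only: nn_exp_time_series[OF order_refl] ennreal_suminf_cmult)
  also have "(\<integral>\<^sup>+\<omega>. indicator (hit {0}) \<omega> * ennreal (exp (c * time 0 (0 + t) \<omega>)) \<partial>M)
      = (\<integral>\<^sup>+\<omega>. ennreal (exp (c * time 0 t \<omega>)) \<partial>M)"
    using start AE_space by (intro nn_integral_cong_AE, eventually_elim) (auto simp: hit_def)
  finally show ?thesis .
qed

definition mgf :: "real \<Rightarrow> real \<Rightarrow> real" where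
  "mgf c t = (\<integral>\<omega>. exp (c * time 0 t \<omega>) \<partial>M)"

lemma exp_time_bounds:
  assumes "0 \<le> c" "0 \<le> t" "\<omega> \<in> space M"
  shows "1 \<le> exp (c * time 0 t \<omega>)" "exp (c * time 0 t \<omega>) \<le> exp (c * t)"
  using assms time_nonneg[of 0 t \<omega>] time_le[of \<omega> 0 t] by (auto intro: mult_left_mono)

lemma exp_time_integrable:
  assumes "0 \<le> c" "0 \<le> t"
  shows "integrable M (\<lambda>\<omega>. exp (c * time 0 t \<omega>))"
proof (rule integrable_const_bound)
  show "AE \<omega> in M. norm (exp (c * time 0 t \<omega>)) \<le> exp (c * t)"
    using exp_time_bounds(2)[OF assms] by (intro AE_I2) simp
qed measurable

lemma mgf_nn_integral:
  assumes "0 \<le> c" "0 \<le> t"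
  shows "ennreal (mgf c t) = (\<integral>\<^sup>+\<omega>. ennreal (exp (c * time 0 t \<omega>)) \<partial>M)"
  unfolding mgf_def by (intro nn_integral_eq_integral[symmetric] exp_time_integrable assms) auto

lemma mgf_ge_one:
  assumes "0 \<le> c" "0 \<le> t"
  shows "1 \<le> mgf c t"
  unfolding mgf_def using exp_time_bounds(1)[OF assms] exp_time_integrable[OF assms]
  by (intro integral_ge_const) (auto intro!: AE_I2)

lemma mgf_mono:
  assumes "0 \<le> c" "0 \<le> s" "s \<le> t"
  shows "mgf c s \<le> mgf c t"
  unfolding mgf_def
proof (intro integral_mono exp_time_integrable)
  show "exp (c * time 0 s \<omega>) \<le> exp (c * time 0 t \<omega>)" if "\<omega> \<in> space M" for \<omega>
    using time_split[OF that, of 0 s t] time_nonneg[of s t \<omega>] assms by (auto intro: mult_left_mono)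
qed (use assms in auto)

text \<open>
  The occupation time grows at most at unit speed; with monotonicity this makes the moment continuous in time.
\<close>
lemma mgf_increment:
  assumes "0 \<le> c" "0 \<le> s" "s \<le> t"
  shows "mgf c t \<le> exp (c * (t - s)) * mgf c s"
proof -
  have "mgf c t \<le> (\<integral>\<omega>. exp (c * (t - s)) * exp (c * time 0 s \<omega>) \<partial>M)"
    unfolding mgf_def
  proof (intro integral_mono exp_time_integrable integrable_mult_right)
    show "exp (c * time 0 t \<omega>) \<le> exp (c * (t - s)) * exp (c * time 0 s \<omega>)" if "\<omega> \<in> space M" for \<omega>
    proof -
      have "c * time 0 t \<omega> \<le> c * ((t - s) + time 0 s \<omega>)"
        using time_split[OF that, of 0 s t] time_le[OF that, of s t] assms by (intro mult_left_mono) auto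
      then show ?thesis by (simp add: exp_add[symmetric] distrib_left)
    qed
  qed (use assms in auto)
  then show ?thesis by (simp add: mgf_def)
qed

lemma mgf_continuous:
  assumes "0 \<le> c"
  shows "continuous_on {0..} (mgf c)"
  unfolding continuous_on_def
proof
  fix x :: real assume x: "x \<in> {0..}"
  show "(mgf c \<longlongrightarrow> mgf c x) (at x within {0..})"
  proof (rule tendsto_sandwich)
    show "\<forall>\<^sub>F y in at x within {0..}. exp (- (c * \<bar>y - x\<bar>)) * mgf c x \<le> mgf c y"
      unfolding eventually_at_filter
    proof (intro always_eventually allI impI)
      fix y assume y: "y \<noteq> x" "y \<in> {0..}"
      have "mgf c x \<le> exp (c * \<bar>y - x\<bar>) * mgf c y"
      proof (cases "x \<le> y")
        case True
        have "1 * mgf c x \<le> exp (c * \<bar>y - x\<bar>) * mgf c y"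
          using True x assms mgf_mono[of c x y] mgf_ge_one[of c x] by (intro mult_mono) auto
        then show ?thesis by simp
      next
        case False
        then show ?thesis using mgf_increment[of c y x] assms y by simp
      qed
      then have "exp (- (c * \<bar>y - x\<bar>)) * mgf c x \<le> exp (- (c * \<bar>y - x\<bar>)) * (exp (c * \<bar>y - x\<bar>) * mgf c y)"
        by (intro mult_left_mono) auto
      also have "\<dots> = mgf c y" by (simp add: mult.assoc[symmetric] exp_add[symmetric])
      finally show "exp (- (c * \<bar>y - x\<bar>)) * mgf c x \<le> mgf c y" .
    qed
    show "\<forall>\<^sub>F y in at x within {0..}. mgf c y \<le> exp (c * \<bar>y - x\<bar>) * mgf c x"
      unfolding eventually_at_filter
    proof (intro always_eventually allI impI)
      fix y assume y: "y \<noteq> x" "y \<in> {0..}"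
      show "mgf c y \<le> exp (c * \<bar>y - x\<bar>) * mgf c x"
      proof (cases "y \<le> x")
        case True
        have "1 * mgf c y \<le> exp (c * \<bar>y - x\<bar>) * mgf c x"
          using True x y assms mgf_mono[of c y x] mgf_ge_one[of c y] by (intro mult_mono) auto
        then show ?thesis by simp
      next
        case False
        then show ?thesis using mgf_increment[of c x y] assms x by simp
      qed
    qed
    have "((\<lambda>y. exp (- (c * \<bar>y - x\<bar>)) * mgf c x) \<longlongrightarrow> exp (- (c * \<bar>x - x\<bar>)) * mgf c x) (at x within {0..})"
      by (intro tendsto_intros)
    then show "((\<lambda>y. exp (- (c * \<bar>y - x\<bar>)) * mgf c x) \<longlongrightarrow> mgf c x) (at x within {0..})" by simp
    have "((\<lambda>y. exp (c * \<bar>y - x\<bar>) * mgf c x) \<longlongrightarrow> exp (c * \<bar>x - x\<bar>) * mgf c x) (at x within {0..})"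
      by (intro tendsto_intros)
    then show "((\<lambda>y. exp (c * \<bar>y - x\<bar>) * mgf c x) \<longlongrightarrow> mgf c x) (at x within {0..})" by simp
  qed
qed

text \<open>
  The expectation of the pathwise identity \<open>exp_integral_identity\<close>, where Fubini and the Markov
  property turn the expected integrand at time \<open>s\<close> into \<open>ret s * mgf c (t - s)\<close>.
\<close>
lemma mgf_renewal:
  assumes "0 \<le> c" "0 \<le> t"
  shows "mgf c t = 1 + c * integral {0..t} (\<lambda>s. ret s * mgf c (t - s))"
proof -
  interpret pair_sigma_finite lborel M ..
  let ?k = "\<lambda>s \<omega>. ennreal (indicator {0..t} s * (visit s \<omega> * exp (c * time s t \<omega>)))"
  have path: "ennreal (exp (c * time 0 t \<omega>)) = 1 + ennreal c * (\<integral>\<^sup>+s. ?k s \<omega> \<partial>lborel)"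
    if "\<omega> \<in> space M" for \<omega>
  proof -
    note id = unit_density.exp_integral_identity[OF unit_density_visit[OF that] assms, folded time_def]
    have "(\<integral>\<^sup>+s. ?k s \<omega> \<partial>lborel) = ennreal (LBINT s:{0..t}. visit s \<omega> * exp (c * time s t \<omega>))"
      unfolding set_lebesgue_integral_def
      using id(1) by (subst nn_integral_eq_integral) (auto simp: set_integrable_def visit_range)
    moreover have "0 \<le> (LBINT s:{0..t}. visit s \<omega> * exp (c * time s t \<omega>))"
      unfolding set_lebesgue_integral_def
      by (intro integral_nonneg_AE AE_I2) (auto simp: visit_range)
    ultimately show ?thesis
      unfolding id(2) using assms by (simp add: ennreal_mult ennreal_plus)
  qed
  have inner: "(\<integral>\<^sup>+\<omega>. ?k s \<omega> \<partial>M) = ennreal (indicator {0..t} s * (ret s * mgf c (t - s)))" for s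
  proof (cases "s \<in> {0..t}")
    case True
    have "(\<integral>\<^sup>+\<omega>. ?k s \<omega> \<partial>M) = (\<integral>\<^sup>+\<omega>. indicator (hit {s}) \<omega> * ennreal (exp (c * time s (s + (t - s)) \<omega>)) \<partial>M)"
      using True by (intro nn_integral_cong) (auto simp: hit_def visit_eq indicator_def)
    also have "\<dots> = ennreal (ret s) * (\<integral>\<^sup>+\<omega>. ennreal (exp (c * time 0 (t - s) \<omega>)) \<partial>M)"
      using True assms by (intro nn_exp_time_shift) auto
    also have "\<dots> = ennreal (ret s * mgf c (t - s))"
      using True assms nonneg[of s] mgf_ge_one[of c "t - s"]
      by (simp add: mgf_nn_integral[symmetric] ennreal_mult)
    finally show ?thesis using True by simp
  qed simp
  have cont: "continuous_on {0..t} (\<lambda>s. ret s * mgf c (t - s))"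
    using assms by (intro continuous_intros continuous_on_subset[OF return_cont]
        continuous_on_compose2[OF mgf_continuous]) auto
  have int: "set_integrable lborel {0..t} (\<lambda>s. ret s * mgf c (t - s))"
    by (rule borel_integrable_atLeastAtMost'[OF cont])
  have pos: "0 \<le> ret s * mgf c (t - s)" if "s \<in> {0..t}" for s
    using that assms nonneg[of s] mgf_ge_one[of c "t - s"] by auto
  have "(\<integral>\<^sup>+\<omega>. \<integral>\<^sup>+s. ?k s \<omega> \<partial>lborel \<partial>M) = (\<integral>\<^sup>+s. \<integral>\<^sup>+\<omega>. ?k s \<omega> \<partial>M \<partial>lborel)"
    by (intro Fubini') measurable
  also have "\<dots> = (\<integral>\<^sup>+s. ennreal (indicator {0..t} s *\<^sub>R (ret s * mgf c (t - s))) \<partial>lborel)"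
    by (simp add: inner)
  also have "\<dots> = ennreal (LBINT s:{0..t}. ret s * mgf c (t - s))"
    unfolding set_lebesgue_integral_def
    using int pos by (intro nn_integral_eq_integral) (auto simp: set_integrable_def indicator_def)
  also have "\<dots> = ennreal (integral {0..t} (\<lambda>s. ret s * mgf c (t - s)))"
    by (simp add: set_borel_integral_eq_integral(2)[OF int])
  finally have swap: "(\<integral>\<^sup>+\<omega>. \<integral>\<^sup>+s. ?k s \<omega> \<partial>lborel \<partial>M) = ennreal (integral {0..t} (\<lambda>s. ret s * mgf c (t - s)))" .
  have Ipos: "0 \<le> integral {0..t} (\<lambda>s. ret s * mgf c (t - s))"
    using pos by (intro Henstock_Kurzweil_Integration.integral_nonneg integrable_continuous_interval cont) auto
  have [measurable]: "(\<lambda>\<omega>. \<integral>\<^sup>+s. ?k s \<omega> \<partial>lborel) \<in> borel_measurable M" by measurable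
  have "ennreal (mgf c t) = (\<integral>\<^sup>+\<omega>. 1 + ennreal c * (\<integral>\<^sup>+s. ?k s \<omega> \<partial>lborel) \<partial>M)"
    unfolding mgf_nn_integral[OF assms] by (intro nn_integral_cong path)
  also have "\<dots> = 1 + ennreal c * (\<integral>\<^sup>+\<omega>. \<integral>\<^sup>+s. ?k s \<omega> \<partial>lborel \<partial>M)"
    by (simp add: nn_integral_add nn_integral_cmult emeasure_space_1)
  also have "\<dots> = ennreal (1 + c * integral {0..t} (\<lambda>s. ret s * mgf c (t - s)))"
    unfolding swap using assms Ipos by (simp add: ennreal_mult ennreal_plus)
  finally show ?thesis
    using mgf_ge_one[OF assms] assms Ipos by (subst (asm) ennreal_inj) auto
qed

lemma mgf_renewal_equation: "0 \<le> c \<Longrightarrow> renewal_equation ret c (mgf c)"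
  by unfold_locales (auto intro: mgf_continuous mgf_mono mgf_ge_one mgf_renewal)

end

section \<open>The exponential growth rate\<close>

context process_from_state
begin

abbreviation growth :: "real \<Rightarrow> real" where
  "growth \<equiv> growth_rate M X i"

lemma log_moment_rate_eq: "log_moment_rate M X i c = (\<lambda>t. 1 / t * ln (mgf c t))"
  by (simp add: log_moment_rate_def fun_eq_iff mgf_def occupation_time_eq)

lemma green_eq: "total_mass = green p i i"
  by (simp add: total_mass_def green_def)

lemma growth_characterisation:
  assumes "0 \<le> c"
  shows log_moment_rate_tendsto: "(log_moment_rate M X i c \<longlongrightarrow> growth c) at_top"
    and growth_nonneg: "0 \<le> growth c"
    and growth_pos_iff: "0 < growth c \<longleftrightarrow> 1 / green p i i < ennreal c"
    and growth_equation: "0 < growth c \<Longrightarrow> c * laplace ret (growth c) = 1"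
    and growth_above: "\<And>l. growth c < l \<Longrightarrow> c * laplace ret l < 1"
proof -
  obtain r where r: "0 \<le> r" "0 < r \<longleftrightarrow> 1 / green p i i < ennreal c" "0 < r \<Longrightarrow> c * laplace ret r = 1"
    "\<And>l. 0 < l \<Longrightarrow> l < r \<Longrightarrow> 1 < c * laplace ret l" "\<And>l. r < l \<Longrightarrow> c * laplace ret l < 1"
    using critical_exponent[OF assms] unfolding green_eq by metis
  have lim: "(log_moment_rate M X i c \<longlongrightarrow> r) at_top"
    unfolding log_moment_rate_eq
    using renewal_equation.rate_tendsto[OF mgf_renewal_equation[OF assms] r(1,4,5)] .
  then have "growth c = r"
    unfolding growth_rate_def by (intro tendsto_Lim) auto
  with lim r show "(log_moment_rate M X i c \<longlongrightarrow> growth c) at_top" "0 \<le> growth c"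
    "0 < growth c \<longleftrightarrow> 1 / green p i i < ennreal c"
    "0 < growth c \<Longrightarrow> c * laplace ret (growth c) = 1"
    "\<And>l. growth c < l \<Longrightarrow> c * laplace ret l < 1" by auto
qed

lemma growth_le:
  assumes "0 \<le> c"
  shows "growth c \<le> c"
proof (rule ccontr)
  assume "\<not> growth c \<le> c"
  then have "c < growth c" "0 < growth c" using assms by auto
  then have "1 = c * laplace ret (growth c)" using growth_equation[OF assms] by simp
  also have "\<dots> \<le> c * (1 / growth c)"
    using \<open>0 < growth c\<close> assms by (intro mult_left_mono laplace_le_inverse)
  also have "\<dots> < 1" using \<open>c < growth c\<close> \<open>0 < growth c\<close> by (simp add: field_simps)
  finally show False by simp
qed

text \<open>
  For \<open>b < 1\<close> and large \<open>c\<close> the product \<open>c * laplace ret (b * c)\<close> is close to \<open>1 / b > 1\<close>, so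
  that \<open>b * c\<close> does not exceed the critical exponent.
\<close>
lemma growth_ratio_tendsto: "((\<lambda>c. growth c / c) \<longlongrightarrow> 1) at_top"
proof (rule order_tendstoI)
  fix a :: real assume "a < 1"
  define b where "b = (max a 0 + 1) / 2"
  have b: "a < b" "0 < b" "b < 1" using \<open>a < 1\<close> by (auto simp: b_def max_def)
  have "filterlim (\<lambda>c. b * c) at_top at_top"
    using b by (intro filterlim_tendsto_pos_mult_at_top[OF tendsto_const _ filterlim_ident])
  then have "((\<lambda>c. b * c * laplace ret (b * c)) \<longlongrightarrow> 1) at_top"
    using filterlim_compose[OF times_laplace_tendsto_one] by blast
  then have "eventually (\<lambda>c. b < b * c * laplace ret (b * c)) at_top"
    using b by (intro order_tendstoD(1)) auto
  then show "eventually (\<lambda>c. a < growth c / c) at_top"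
    using eventually_gt_at_top[of 0]
  proof eventually_elim
    case (elim c)
    have "b * 1 < b * (c * laplace ret (b * c))" using elim by (simp add: mult.assoc)
    then have "1 < c * laplace ret (b * c)" using b by (simp only: mult_less_cancel_left_pos)
    then have "b * c \<le> growth c" using growth_above[of c "b * c"] elim by force
    then have "b \<le> growth c / c" using elim by (simp add: field_simps)
    then show ?case using b by simp
  qed
next
  fix a :: real assume "1 < a"
  show "eventually (\<lambda>c. growth c / c < a) at_top"
    using eventually_gt_at_top[of 0]
  proof eventually_elim
    case (elim c)
    then have "growth c / c \<le> 1" using growth_le[of c] by simp
    then show ?case using \<open>1 < a\<close> by simp
  qed
qed

lemma ln_mgf_convex:
  assumes "0 \<le> x" "0 \<le> y" "0 \<le> u" "u \<le> 1" "0 \<le> t"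
  shows "ln (mgf ((1 - u) * x + u * y) t) \<le> (1 - u) * ln (mgf x t) + u * ln (mgf y t)"
proof -
  let ?z = "(1 - u) * x + u * y"
  let ?K = "(1 - u) * ln (mgf x t) + u * ln (mgf y t)"
  have z: "0 \<le> ?z" using assms by auto
  have pos: "0 < mgf x t" "0 < mgf y t" "0 < mgf ?z t"
    using mgf_ge_one[of _ t] assms z by (auto intro: less_le_trans[OF zero_less_one])
  \<comment> \<open>Normalising both exponentials to mean one reduces Hoelder's inequality to convexity of the exponential.\<close>
  have pt: "exp (?z * time 0 t \<omega>) \<le>
      exp ?K * ((1 - u) * (exp (x * time 0 t \<omega>) / mgf x t) + u * (exp (y * time 0 t \<omega>) / mgf y t))" for \<omega>
  proof -
    let ?a = "x * time 0 t \<omega> - ln (mgf x t)" and ?b = "y * time 0 t \<omega> - ln (mgf y t)"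
    have "?z * time 0 t \<omega> = ?K + ((1 - u) * ?a + u * ?b)" by (simp add: algebra_simps)
    then have "exp (?z * time 0 t \<omega>) = exp ?K * exp ((1 - u) * ?a + u * ?b)"
      by (simp only: exp_add)
    also have "\<dots> \<le> exp ?K * ((1 - u) * exp ?a + u * exp ?b)"
      using convex_onD[OF exp_convex, of u ?a ?b] assms by (intro mult_left_mono) auto
    also have "exp ?a = exp (x * time 0 t \<omega>) / mgf x t" using pos by (simp add: exp_diff)
    also have "exp ?b = exp (y * time 0 t \<omega>) / mgf y t" using pos by (simp add: exp_diff)
    finally show ?thesis .
  qed
  have ints: "integrable M (\<lambda>\<omega>. exp (x * time 0 t \<omega>))" "integrable M (\<lambda>\<omega>. exp (y * time 0 t \<omega>))"
    "integrable M (\<lambda>\<omega>. exp (?z * time 0 t \<omega>))"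
    using assms z by (auto intro: exp_time_integrable)
  have "mgf ?z t \<le> (\<integral>\<omega>. exp ?K * ((1 - u) * (exp (x * time 0 t \<omega>) / mgf x t) + u * (exp (y * time 0 t \<omega>) / mgf y t)) \<partial>M)"
    unfolding mgf_def[of ?z] using ints pt by (intro integral_mono) auto
  also have "\<dots> = exp ?K * ((1 - u) * (mgf x t / mgf x t) + u * (mgf y t / mgf y t))"
    using ints by (simp add: mgf_def)
  also have "\<dots> = exp ?K" using pos by simp
  finally have "ln (mgf ?z t) \<le> ln (exp ?K)" using pos by (subst ln_le_cancel_iff) auto
  then show ?thesis by simp
qed

lemma growth_convex: "convex_on {0..} growth"
proof (rule convex_onI)
  fix u x y :: real assume u: "0 < u" "u < 1" and xy: "x \<in> {0..}" "y \<in> {0..}"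
  let ?z = "(1 - u) * x + u * y"
  have z: "0 \<le> ?z" using u xy by auto
  have "growth ?z \<le> (1 - u) * growth x + u * growth y"
  proof (rule tendsto_le[OF _ _ log_moment_rate_tendsto[OF z]])
    show "((\<lambda>t. (1 - u) * log_moment_rate M X i x t + u * log_moment_rate M X i y t)
        \<longlongrightarrow> (1 - u) * growth x + u * growth y) at_top"
      using xy by (intro tendsto_intros log_moment_rate_tendsto) auto
    show "eventually (\<lambda>t. log_moment_rate M X i ?z t
        \<le> (1 - u) * log_moment_rate M X i x t + u * log_moment_rate M X i y t) at_top"
      using eventually_gt_at_top[of 0]
    proof eventually_elim
      case (elim t)
      have "1 / t * ln (mgf ?z t) \<le> 1 / t * ((1 - u) * ln (mgf x t) + u * ln (mgf y t))"
        using elim u xy by (intro mult_left_mono ln_mgf_convex) auto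
      then show ?case by (simp add: log_moment_rate_eq add_divide_distrib)
    qed
  qed simp
  then show "growth ((1 - u) *\<^sub>R x + u *\<^sub>R y) \<le> (1 - u) * growth x + u * growth y" by simp
qed simp

lemma supercritical_convex: "convex {c. 0 \<le> c \<and> 1 / green p i i < ennreal c}"
proof -
  have "d \<in> {c. 0 \<le> c \<and> 1 / green p i i < ennreal c}"
    if "c \<in> {c. 0 \<le> c \<and> 1 / green p i i < ennreal c}" "c \<le> d" for c d
    using that by (auto intro: less_le_trans ennreal_leI)
  then have "is_interval {c. 0 \<le> c \<and> 1 / green p i i < ennreal c}"
    unfolding is_interval_1 by blast
  then show ?thesis by (simp add: is_interval_convex)
qed

text \<open>
  Returning to \<open>i\<close> at time \<open>s + t\<close> is possible also through \<open>j \<noteq> i\<close> at time \<open>s\<close>, which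
  makes the supermultiplicativity of \<open>ret\<close> strict.
\<close>
lemma not_exponential:
  assumes "can_leave_and_return S p i"
  shows "\<not> (\<forall>t\<ge>0. ret t = exp (- (b * t)))"
proof
  assume exp: "\<forall>t\<ge>0. ret t = exp (- (b * t))"
  obtain j s t where j: "j \<in> S" "j \<noteq> i" "0 \<le> s" "0 \<le> t" "0 < p s i j" "0 < p t j i"
    using assms by (auto simp: can_leave_and_return_def)
  have "ret s * ret t + p s i j * p t j i \<le> ret (s + t)"
    using ret_plus_lower_bound[of s t "{i, j}"] j state by simp
  moreover have "ret (s + t) = ret s * ret t"
    using exp j by (simp add: exp_add[symmetric] algebra_simps)
  moreover have "0 < p s i j * p t j i" using j by simp
  ultimately show False by linarith
qed

text \<open>
  Above the threshold, \<open>growth c = l\<close> means \<open>c * laplace ret l = 1\<close>. An affine piece \<open>growth c = k * c + b\<close> thus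
  becomes the identity \<open>laplace ret l * (l - b) = k\<close> on an interval, which makes \<open>ret\<close> an exponential.
\<close>
lemma growth_not_affine:
  assumes leave: "can_leave_and_return S p i"
    and "0 \<le> z" "1 / green p i i < ennreal z" "0 < h"
    and affine: "\<And>c. c \<in> {z..z + h} \<Longrightarrow> growth c = k * c + b"
  shows False
proof -
  have super: "0 \<le> c" "0 < growth c" "c * laplace ret (growth c) = 1" if "c \<in> {z..z + h}" for c
  proof -
    have "ennreal z \<le> ennreal c" using that by (intro ennreal_leI) auto
    then have "1 / green p i i < ennreal c" using assms(3) by (rule less_le_trans[rotated])
    moreover show "0 \<le> c" using that assms by auto
    ultimately show "0 < growth c" by (simp add: growth_pos_iff)
    then show "c * laplace ret (growth c) = 1" using \<open>0 \<le> c\<close> by (rule growth_equation[rotated])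
  qed
  have ends: "z \<in> {z..z + h}" "z + h \<in> {z..z + h}" using assms by auto
  have "0 < k"
  proof (rule ccontr)
    assume "\<not> 0 < k"
    then have "growth (z + h) \<le> growth z"
      using affine ends \<open>0 < h\<close> by (simp add: distrib_left mult_nonpos_nonneg)
    then have "laplace ret (growth z) \<le> laplace ret (growth (z + h))"
      using super(2)[OF ends(2)] by (rule laplace_antimono[rotated])
    then have "z * laplace ret (growth z) \<le> z * laplace ret (growth (z + h))"
      using \<open>0 \<le> z\<close> by (rule mult_left_mono)
    also have "\<dots> < (z + h) * laplace ret (growth (z + h))"
      using \<open>0 < h\<close> laplace_pos[OF super(2)[OF ends(2)]] by simp
    finally show False using super(3)[OF ends(1)] super(3)[OF ends(2)] by simp
  qed
  define q where "q = k * (z + h) + b"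
  have id: "laplace ret l * (l - b) = k" if "growth z < l" "l < q" for l
  proof -
    define c where "c = (l - b) / k"
    have l: "l = k * c + b" using \<open>0 < k\<close> by (simp add: c_def)
    then have "k * z < k * c" "k * c < k * (z + h)"
      using that affine[OF ends(1)] by (auto simp: q_def)
    then have c: "c \<in> {z..z + h}" using \<open>0 < k\<close> by simp
    have "growth c = l" using affine[OF c] l by simp
    then have "c * laplace ret l = 1" using super(3)[OF c] by simp
    moreover have "l - b = k * c" using l by simp
    ultimately show ?thesis by (simp add: mult_ac)
  qed
  have "growth z < q" using affine[OF ends(1)] \<open>0 < k\<close> \<open>0 < h\<close> by (simp add: q_def algebra_simps)
  then have reciprocal: "b \<le> 0" "\<And>l. 0 < l \<Longrightarrow> laplace ret l * (l - b) = 1"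
    using laplace_reciprocal_affine[OF super(2)[OF ends(1)]] id by blast+
  have "laplace ret l * (l + (- b)) = 1" if "0 < l" for l
    using reciprocal(2)[OF that] by simp
  then have "ret t = exp (- (- b * t))" if "0 \<le> t" for t
    using reciprocal(1) that by (intro exponential_of_laplace ret_supermultiplicative) auto
  then show False using not_exponential[OF leave, of "- b"] by blast
qed

lemma growth_strictly_convex:
  assumes "can_leave_and_return S p i"
  shows "strictly_convex_on {c. 0 \<le> c \<and> 1 / green p i i < ennreal c} growth"
proof (rule strictly_convex_onI[OF supercritical_convex])
  fix x y u assume x: "x \<in> {c. 0 \<le> c \<and> 1 / green p i i < ennreal c}"
    and "x < y" and u: "0 < u" "u < (1::real)"
  show "growth ((1 - u) * x + u * y) < (1 - u) * growth x + u * growth y"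
  proof (rule ccontr)
    assume "\<not> ?thesis"
    then have touch: "(1 - u) * growth x + u * growth y \<le> growth ((1 - u) * x + u * y)" by simp
    have conv: "convex_on {x..y} growth"
      using growth_convex by (rule convex_on_subset) (use x in auto)
    obtain z h where zh: "x < z" "0 < h"
      "\<And>c. c \<in> {z..z + h} \<Longrightarrow> growth c = growth x + (growth y - growth x) / (y - x) * (c - x)"
      using convex_touching_chord_affine[OF conv \<open>x < y\<close> u touch] by metis
    define k where "k = (growth y - growth x) / (y - x)"
    have affine: "growth c = k * c + (growth x - k * x)" if "c \<in> {z..z + h}" for c
      using zh(3)[OF that] unfolding k_def[symmetric] by (simp add: algebra_simps)
    have "1 / green p i i < ennreal z"
      using x zh(1) by (auto intro: less_le_trans ennreal_leI)
    moreover have "0 \<le> z" using x zh(1) by auto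
    ultimately show False
      using growth_not_affine[OF assms _ _ zh(2) affine] by blast
  qed
qed

end

theorem corollary1:
  fixes M :: "'w measure" and S :: "'s set" and X :: "real \<Rightarrow> 'w \<Rightarrow> 's"
    and p :: "real \<Rightarrow> 's \<Rightarrow> 's \<Rightarrow> real" and i :: 's
  assumes "homogeneous_markov_process M S X p"
    and "i \<in> S"
    and "AE \<omega> in M. X 0 \<omega> = i"
    and "continuous_on {0..} (\<lambda>t. p t i i)"
  shows "(\<forall>\<gamma>\<ge>0. (log_moment_rate M X i \<gamma> \<longlongrightarrow> growth_rate M X i \<gamma>) at_top)
    \<and> (\<forall>\<gamma>\<ge>0. 0 \<le> growth_rate M X i \<gamma> \<and>
          (0 < growth_rate M X i \<gamma> \<longleftrightarrow> 1 / green p i i < ennreal \<gamma>))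
    \<and> (can_leave_and_return S p i \<longrightarrow>
          strictly_convex_on {\<gamma>. 0 \<le> \<gamma> \<and> 1 / green p i i < ennreal \<gamma>} (growth_rate M X i))
    \<and> (\<forall>\<gamma>\<ge>0. growth_rate M X i \<gamma> \<le> \<gamma>)
    \<and> ((\<lambda>\<gamma>. growth_rate M X i \<gamma> / \<gamma>) \<longlongrightarrow> 1) at_top"
proof -
  interpret process_from_state M S X p i
    using assms by (intro process_from_state.intro process_from_state_axioms.intro)
  show ?thesis
  proof (intro conjI allI impI)
    fix \<gamma> :: real assume "0 \<le> \<gamma>"
    then show "(log_moment_rate M X i \<gamma> \<longlongrightarrow> growth_rate M X i \<gamma>) at_top"
      "0 \<le> growth_rate M X i \<gamma>"
      "0 < growth_rate M X i \<gamma> \<longleftrightarrow> 1 / green p i i < ennreal \<gamma>"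
      "growth_rate M X i \<gamma> \<le> \<gamma>"
      by (rule log_moment_rate_tendsto growth_nonneg growth_pos_iff growth_le)+
  qed (rule growth_strictly_convex growth_ratio_tendsto, assumption?)+
qed

end
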